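(* Let $n\in\mathbb{N}$, $\delta\in\{0,1\}$ and let $I\subseteq[n-1]_0$. The polynomials $$f_{F_{n,\delta},I}(X)=\binom{n}{I}_{X^2}(X^{2(i_1+\delta)+1};X^2)_{n-i_1},\qquad f_{G_n,I}(X)=\binom{n}{I}_X(X^{i_1+1};X)_{n-i_1}$$ satisfy the identities $$f_{F_{n,\delta},I}(X)=\sum_{w\in B_n^{I^c}}(-1)^{\mathrm{neg}(w)}X^{(2l+(2\delta-1)\mathrm{neg})(w)},\qquad f_{G_n,I}(X)=\sum_{w\in B_n^{I^c}}(-1)^{\mathrm{neg}(w)}X^{l(w)}.$$
   Context: $[n-1]_0=\{0,\dots,n-1\}$. For $I=\{i_1<\dots<i_l\}\subseteq[n-1]_0$, $i_1$ is the least element, with $i_1=n$ if $I=\varnothing$. Put $(\underline{N})_X!=\prod_{k=1}^N(1-X^k)$, $\binom{a}{b}_X=\frac{(\underline a)_X!}{(\underline{a-b})_X!\,(\underline b)_X!}$, $\binom{n}{I}_X=\binom{n}{i_l}_X\binom{i_l}{i_{l-1}}_X\cdots\binom{i_2}{i_1}_X$ ($=1$ for $I=\varnothing$), and $(X;Y)_k=\prod_{i=0}^{k-1}(1-XY^i)$. $B_n$ is the group of bijections $w$ of $\{-n,\dots,n\}$ with $w(-i)=-w(i)$ for all $i$. Its standard Coxeter generators are $s_0,\dots,s_{n-1}$, where $s_0$ sends $1\mapsto-1$ and fixes $2,\dots,n$, and for $1\le i\le n-1$, $s_i$ exchanges $i$ and $i+1$ and fixes the other elements of $\{1,\dots,n\}$.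 $l$ is the Coxeter length, $D(w)=\{i\in[n-1]_0\mid l(ws_i)<l(w)\}$, $\mathrm{neg}(w)=\#\{i\in\{1,\dots,n\}\mid w(i)<0\}$, and $B_n^{I^c}=\{w\in B_n\mid D(w)\subseteq I\}$. *)

theory Defs
  imports "HOL-Combinatorics.Permutations" "HOL-Computational_Algebra.Polynomial"
begin

section \<open>Gaussian binomial and multinomial coefficients\<close>

definition qfact :: "'a::comm_ring_1 \<Rightarrow> nat \<Rightarrow> 'a" where
  "qfact X N = (\<Prod>k=1..N. 1 - X ^ k)"

text \<open>The operation \<open>div\<close> is only used for exact division, see \<open>qfact_mult_dvd\<close> below.\<close>

definition qbinom :: "'a::idom_divide \<Rightarrow> nat \<Rightarrow> nat \<Rightarrow> 'a" where
  "qbinom X a b = qfact X a div (qfact X (a - b) * qfact X b)"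

text \<open>For \<open>I = {i\<^sub>1 < \<dots> < i\<^sub>l}\<close> the list below is \<open>[i\<^sub>1, \<dots>, i\<^sub>l, n]\<close>.\<close>

definition qmultinom :: "'a::idom_divide \<Rightarrow> nat \<Rightarrow> nat set \<Rightarrow> 'a" where
  "qmultinom X n I =
     (let is = sorted_list_of_set I @ [n]
      in \<Prod>j<card I. qbinom X (is ! Suc j) (is ! j))"

definition qpoch :: "'a::comm_ring_1 \<Rightarrow> 'a \<Rightarrow> nat \<Rightarrow> 'a" where
  "qpoch X Y k = (\<Prod>i<k. 1 - X * Y ^ i)"

definition least_index :: "nat \<Rightarrow> nat set \<Rightarrow> nat" where
  "least_index n I = (if I = {} then n else Min I)"

lemma qfact_Suc: "qfact X (Suc N) = qfact X N * (1 - X ^ Suc N)"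
  by (simp add: qfact_def)

lemma qfact_mult_dvd: "qfact X m * qfact X k dvd qfact X (m + k)"
proof (induction "m + k" arbitrary: m k)
  case 0
  then show ?case by (simp add: qfact_def)
next
  case (Suc N)
  show ?case
  proof (cases "m = 0 \<or> k = 0")
    case True
    then show ?thesis by (auto simp: qfact_def)
  next
    case False
    then obtain m' k' where mk: "m = Suc m'" "k = Suc k'"
      by (meson not0_implies_Suc)
    have "qfact X m' * qfact X k dvd qfact X N" "qfact X m * qfact X k' dvd qfact X N"
      using Suc.hyps(1)[of m' k] Suc.hyps(1)[of m k'] Suc.hyps(2) mk by simp_all
    then obtain A B where A: "qfact X N = qfact X m' * qfact X k * A"
      and B: "qfact X N = qfact X m * qfact X k' * B"
      by (elim dvdE)
    have N: "m + k = Suc N" using Suc.hyps(2) by simp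
    have "qfact X (m + k) = qfact X N * (1 - X ^ m) + X ^ m * (qfact X N * (1 - X ^ k))"
      unfolding N qfact_Suc using N[symmetric] by (simp add: algebra_simps flip: power_add)
    also have "\<dots> = qfact X m' * qfact X k * A * (1 - X ^ m)
                   + X ^ m * (qfact X m * qfact X k' * B * (1 - X ^ k))"
      using A B by simp
    also have "\<dots> = qfact X m * qfact X k * (A + X ^ m * B)"
      unfolding mk qfact_Suc by (simp add: algebra_simps)
    finally show ?thesis by simp
  qed
qed


section \<open>The hyperoctahedral group as a Coxeter group\<close>

text \<open>
  Elements are represented as permutations of the integers that fix everything outside
  \<open>{-n..n}\<close>; the group operation is composition of functions.
\<close>

definition hyperoctahedral :: "nat \<Rightarrow> (int \<Rightarrow> int) set" where
  "hyperoctahedral n = {w. w permutes {- int n..int n} \<and> (\<forall>i. w (- i) = - w i)}"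

definition cox_gen :: "nat \<Rightarrow> int \<Rightarrow> int" where
  "cox_gen i =
     (if i = 0 then transpose 1 (- 1)
      else transpose (int i) (int i + 1) \<circ> transpose (- int i) (- (int i + 1)))"

definition cox_word :: "nat list \<Rightarrow> int \<Rightarrow> int" where
  "cox_word is = foldr (\<lambda>i v. cox_gen i \<circ> v) is id"

definition cox_length :: "nat \<Rightarrow> (int \<Rightarrow> int) \<Rightarrow> nat" where
  "cox_length n w = (LEAST k. \<exists>is. length is = k \<and> set is \<subseteq> {..<n} \<and> cox_word is = w)"

definition descents :: "nat \<Rightarrow> (int \<Rightarrow> int) \<Rightarrow> nat set" where
  "descents n w = {i. i < n \<and> cox_length n (w \<circ> cox_gen i) < cox_length n w}"

definition neg_count :: "nat \<Rightarrow> (int \<Rightarrow> int) \<Rightarrow> nat" where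
  "neg_count n w = card {i \<in> {1..int n}. w i < 0}"

definition parabolic_quotient :: "nat \<Rightarrow> nat set \<Rightarrow> (int \<Rightarrow> int) set" where
  "parabolic_quotient n I = {w \<in> hyperoctahedral n. descents n w \<subseteq> I}"


section \<open>The polynomials\<close>

abbreviation pX :: "int poly" where
  "pX \<equiv> monom 1 1"

definition f_F :: "nat \<Rightarrow> nat \<Rightarrow> nat set \<Rightarrow> int poly" where
  "f_F n \<delta> I =
     qmultinom (pX ^ 2) n I
     * qpoch (pX ^ (2 * (least_index n I + \<delta>) + 1)) (pX ^ 2) (n - least_index n I)"

definition f_G :: "nat \<Rightarrow> nat set \<Rightarrow> int poly" where
  "f_G n I =
     qmultinom pX n I * qpoch (pX ^ (least_index n I + 1)) pX (n - least_index n I)"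

text \<open>
  The exponent \<open>2 l(w) + (2 \<delta> - 1) neg(w)\<close>, computed in the integers. It is nonnegative on
  the group, so that \<open>nat\<close> does not truncate; see \<open>F_exponent_nonneg\<close> below.
\<close>

definition F_exponent :: "nat \<Rightarrow> nat \<Rightarrow> (int \<Rightarrow> int) \<Rightarrow> int" where
  "F_exponent n \<delta> w =
     2 * int (cox_length n w) + (2 * int \<delta> - 1) * int (neg_count n w)"

subsection \<open>Nonnegativity of the exponent\<close>

lemma cox_gen_0: "cox_gen 0 j = (if j = 1 then -1 else if j = -1 then 1 else j)"
  by (auto simp: cox_gen_def transpose_def)

lemma cox_gen_pos:
  assumes "i > 0"
  shows "cox_gen i j =
    (if j = int i then int i + 1 else if j = int i + 1 then int i
     else if j = - int i then - (int i + 1) else if j = - (int i + 1) then - int i else j)"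
  using assms by (auto simp: cox_gen_def transpose_def)

lemma cox_gen_invol: "cox_gen i \<circ> cox_gen i = id"
  by (cases "i = 0") (auto simp: fun_eq_iff cox_gen_0 cox_gen_pos)

lemma cox_gen_in:
  assumes "i < n"
  shows "cox_gen i \<in> hyperoctahedral n"
proof -
  have "cox_gen i permutes {- int n..int n}"
  proof (rule bij_imp_permutes)
    have "bij (cox_gen i)" using cox_gen_invol[of i] by (simp add: o_bij)
    moreover have sub: "cox_gen i ` {- int n..int n} \<subseteq> {- int n..int n}"
      using assms by (cases "i = 0") (auto simp: cox_gen_0 cox_gen_pos)
    moreover have "cox_gen i ` {- int n..int n} = {- int n..int n}"
      using endo_inj_surj[OF _ sub] inj_on_subset[OF bij_is_inj[OF calculation(1)] subset_UNIV]
      by simp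
    ultimately show "bij_betw (cox_gen i) {- int n..int n} {- int n..int n}"
      by (metis bij_def bij_betw_def inj_on_subset subset_UNIV)
    show "\<And>x. x \<notin> {- int n..int n} \<Longrightarrow> cox_gen i x = x"
      using assms by (cases "i = 0") (auto simp: cox_gen_0 cox_gen_pos)
  qed
  moreover have "cox_gen i (- j) = - cox_gen i j" for j
    by (cases "i = 0") (auto simp: cox_gen_0 cox_gen_pos)
  ultimately show ?thesis by (simp add: hyperoctahedral_def)
qed

lemma hyperoctahedral_comp:
  "v \<in> hyperoctahedral n \<Longrightarrow> w \<in> hyperoctahedral n \<Longrightarrow> v \<circ> w \<in> hyperoctahedral n"
  by (auto simp: hyperoctahedral_def intro: permutes_compose)

lemma cox_word_append: "cox_word (xs @ ys) = cox_word xs \<circ> cox_word ys"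
  by (induction xs) (simp_all add: cox_word_def fun.map_comp comp_assoc)

lemma hyperoctahedral_no_descent_id:
  assumes w: "w \<in> hyperoctahedral n"
    and pos: "n > 0 \<Longrightarrow> w 1 > 0"
    and mono: "\<And>i. 0 < i \<Longrightarrow> i < n \<Longrightarrow> w (int i) < w (int i + 1)"
  shows "w = id"
proof -
  have perm: "w permutes {- int n..int n}" and odd: "\<And>i. w (- i) = - w i"
    using w by (auto simp: hyperoctahedral_def)
  have lower: "0 < i \<Longrightarrow> i \<le> n \<Longrightarrow> w (int i) \<ge> int i" for i
  proof (induction i)
    case (Suc i)
    show ?case
    proof (cases "i = 0")
      case True
      then show ?thesis using pos Suc.prems by simp
    next
      case False
      then show ?thesis using mono[of i] Suc by (simp add: add.commute)
    qed
  qed simp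
  have upper: "k < n \<Longrightarrow> w (int (n - k)) \<le> int (n - k)" for k
  proof (induction k)
    case 0
    have "int n \<in> {- int n..int n}" by simp
    then have "w (int n) \<in> {- int n..int n}" using permutes_in_image[OF perm] by blast
    then show ?case by simp
  next
    case (Suc k)
    have "int (n - Suc k) + 1 = int (n - k)" using Suc.prems by simp
    then show ?case using mono[of "n - Suc k"] Suc by simp
  qed
  have nat_fix: "w (int i) = int i" if "0 < i" "i \<le> n" for i
    using lower[OF that] upper[of "n - i"] that by simp
  have zero: "w 0 = 0" using odd[of 0] by simp
  have "w j = j" for j
  proof (cases "j \<in> {- int n..int n}")
    case False
    then show ?thesis using permutes_not_in[OF perm] by blast
  next
    case True
    consider "j = 0" | "j > 0" | "j < 0" by linarith
    then show ?thesis
    proof cases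
      case 1
      then show ?thesis using zero by simp
    next
      case 2
      then show ?thesis using nat_fix[of "nat j"] True by simp
    next
      case 3
      then show ?thesis using nat_fix[of "nat (- j)"] odd[of j] True by simp
    qed
  qed
  then show ?thesis by (simp add: fun_eq_iff)
qed

lemma hyperoctahedral_generated:
  assumes "w \<in> hyperoctahedral n"
  shows "\<exists>is. set is \<subseteq> {..<n} \<and> cox_word is = w"
proof -
  define \<Phi> where "\<Phi> w = (\<Sum>j\<in>{1..int n}. j * w j)" for w :: "int \<Rightarrow> int"
  have bound: "\<Phi> v \<le> int n * (int n * int n)" if "v \<in> hyperoctahedral n" for v
  proof -
    have "j * v j \<le> int n * int n" if "j \<in> {1..int n}" for j
    proof -
      have "v j \<in> {- int n..int n}"
        using \<open>v \<in> hyperoctahedral n\<close> that permutes_in_image[of v "{- int n..int n}" j]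
        by (auto simp: hyperoctahedral_def)
      then have "j * v j \<le> j * int n" using that by (intro mult_left_mono) auto
      also have "\<dots> \<le> int n * int n" using that by (intro mult_right_mono) auto
      finally show ?thesis .
    qed
    then have "\<Phi> v \<le> of_nat (card {1..int n}) * (int n * int n)"
      unfolding \<Phi>_def by (intro sum_bounded_above) auto
    then show ?thesis by simp
  qed
  show ?thesis using assms
  proof (induction "nat (int n * (int n * int n) - \<Phi> w)" arbitrary: w rule: less_induct)
    case less
    have odd: "\<And>i. w (- i) = - w i" and inj: "inj w"
      using less.prems by (auto simp: hyperoctahedral_def permutes_inj)
    have zero: "w 0 = 0" using odd[of 0] by simp
    show ?case
    proof (cases "\<exists>i<n. \<Phi> (w \<circ> cox_gen i) > \<Phi> w")
      case True
      then obtain i where i: "i < n" "\<Phi> (w \<circ> cox_gen i) > \<Phi> w" by blast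
      have mem: "w \<circ> cox_gen i \<in> hyperoctahedral n"
        using less.prems cox_gen_in[OF i(1)] by (rule hyperoctahedral_comp)
      have "nat (int n * (int n * int n) - \<Phi> (w \<circ> cox_gen i))
          < nat (int n * (int n * int n) - \<Phi> w)"
        using i(2) bound[OF mem] by linarith
      from less.hyps[OF this mem] obtain xs
        where xs: "set xs \<subseteq> {..<n}" "cox_word xs = w \<circ> cox_gen i" by blast
      have "cox_word (xs @ [i]) = w \<circ> (cox_gen i \<circ> cox_gen i)"
        using xs(2) by (simp add: cox_word_append comp_assoc) (simp add: cox_word_def)
      then have "cox_word (xs @ [i]) = w" by (simp add: cox_gen_invol)
      then show ?thesis using xs(1) i(1) by (intro exI[of _ "xs @ [i]"]) auto
    next
      case False
      have "w = id"
      proof (rule hyperoctahedral_no_descent_id[OF less.prems])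
        assume n: "n > 0"
        have split: "{1..int n} = insert 1 {2..int n}" using n by auto
        have "(\<Sum>j\<in>{2..int n}. j * (w \<circ> cox_gen 0) j) = (\<Sum>j\<in>{2..int n}. j * w j)"
          by (intro sum.cong) (auto simp: cox_gen_0)
        then have "\<Phi> (w \<circ> cox_gen 0) = \<Phi> w - 2 * w 1"
          unfolding \<Phi>_def split using odd[of 1] by (simp add: cox_gen_0)
        moreover have "w 1 \<noteq> 0" using inj_eq[OF inj, of 1 0] zero by simp
        ultimately show "w 1 > 0" using False n by force
      next
        fix i assume i: "0 < i" "i < n"
        let ?R = "{1..int n} - {int i, int i + 1}"
        have split: "{1..int n} = insert (int i) (insert (int i + 1) ?R)" using i by auto
        have expand: "(\<Sum>j\<in>{1..int n}. f j) = f (int i) + f (int i + 1) + (\<Sum>j\<in>?R. f j)"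
          for f :: "int \<Rightarrow> int"
          by (subst split) simp
        have "(\<Sum>j\<in>?R. j * (w \<circ> cox_gen i) j) = (\<Sum>j\<in>?R. j * w j)"
          using i by (intro sum.cong) (auto simp: cox_gen_pos)
        then have "\<Phi> (w \<circ> cox_gen i) = \<Phi> w + (w (int i) - w (int i + 1))"
          unfolding \<Phi>_def expand using i by (simp add: cox_gen_pos algebra_simps)
        moreover have "w (int i) \<noteq> w (int i + 1)" using inj_eq[OF inj] by simp
        ultimately show "w (int i) < w (int i + 1)" using False i by force
      qed
      then show ?thesis by (intro exI[of _ "[]"]) (simp add: cox_word_def)
    qed
  qed
qed

lemma neg_count_cox_word:
  assumes "set is \<subseteq> {..<n}"
  shows "neg_count n (cox_word is) \<le> length is"
  using assms
proof (induction "is" rule: rev_induct)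
  case Nil
  have "{i \<in> {1..int n}. id i < 0} = {}" by auto
  then show ?case unfolding neg_count_def cox_word_def by (simp only: foldr.simps id_apply) simp
next
  case (snoc i xs)
  let ?w = "cox_word xs" and ?g = "cox_gen i"
  have i: "i < n" using snoc.prems by simp
  have w': "cox_word (xs @ [i]) = ?w \<circ> ?g"
    unfolding cox_word_append by (simp add: cox_word_def)
  have "neg_count n (?w \<circ> ?g) \<le> Suc (neg_count n ?w)"
  proof -
    let ?N = "{j \<in> {1..int n}. ?w j < 0}"
    have "inj ?g" using cox_gen_invol[of i] by (metis inj_on_id inj_on_imageI2)
    have "?g ` {j \<in> {1..int n}. (?w \<circ> ?g) j < 0} \<subseteq> insert (- 1) ?N"
      using i by (cases "i = 0") (auto simp: cox_gen_0 cox_gen_pos)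
    moreover have "finite ?N" by (rule finite_subset[of _ "{1..int n}"]) auto
    ultimately have "card (?g ` {j \<in> {1..int n}. (?w \<circ> ?g) j < 0}) \<le> card (insert (- 1) ?N)"
      by (intro card_mono finite.insertI)
    also have "\<dots> \<le> Suc (card ?N)" by (rule card_insert_le_m1) auto
    finally show ?thesis
      using \<open>inj ?g\<close> by (simp add: neg_count_def card_image inj_on_subset[OF _ subset_UNIV])
  qed
  moreover have "neg_count n ?w \<le> length xs" using snoc by simp
  ultimately show ?case unfolding w' by (metis Suc_le_mono le_trans length_append_singleton)
qed

lemma neg_count_le_cox_length:
  assumes "w \<in> hyperoctahedral n"
  shows "neg_count n w \<le> cox_length n w"
proof -
  have "\<exists>k is. length is = k \<and> set is \<subseteq> {..<n} \<and> cox_word is = w"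
    using hyperoctahedral_generated[OF assms] by blast
  from LeastI_ex[OF this] obtain xs
    where "length xs = cox_length n w" "set xs \<subseteq> {..<n}" "cox_word xs = w"
    unfolding cox_length_def by blast
  then show ?thesis using neg_count_cox_word[of xs n] by simp
qed

lemma F_exponent_nonneg:
  assumes "w \<in> hyperoctahedral n"
  shows "F_exponent n \<delta> w \<ge> 0"
proof -
  have "- int (neg_count n w) \<le> (2 * int \<delta> - 1) * int (neg_count n w)"
    by (simp add: algebra_simps)
  then show ?thesis
    using neg_count_le_cox_length[OF assms] by (simp add: F_exponent_def)
qed

end

theory Submission
  imports Defs
begin

text \<open>
  Both identities are specialisations of one: if \<open>s\<^sub>0\<close> has weight \<open>t\<close> and the other generators
  have weight \<open>q\<close>, the generating function of \<open>parabolic_quotient n I\<close> is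
  \<open>binom(n, I)\<^sub>q \<Prod>\<^bsub>i\<^sub>1 \<le> i < n\<^esub> (1 + t q\<^sup>i)\<close>; take \<open>(q, t) = (X\<^sup>2, -X\<^bsup>2\<delta>+1\<^esup>)\<close> and \<open>(X, -X)\<close>.
  With \<open>m = max I\<close>, every \<open>w\<close> in the quotient for \<open>I\<close> factors uniquely as \<open>u v\<close> with \<open>u\<close> in the
  quotient of \<open>B\<^sub>n\<close> for \<open>{m}\<close> and \<open>v\<close> in the quotient of \<open>B\<^sub>m\<close> for \<open>I - {m}\<close>, and the weights
  multiply. This leaves \<open>I = {m}\<close>, where the position of \<open>\<plusminus>(n + 1)\<close> gives the Pascal-type
  recursion \<open>R(n+1, m) = q\<^bsup>n+1-m\<^esup> R(n, m-1) + (1 + t q\<^bsup>n+m\<^esup>) R(n, m)\<close>.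
\<close>

section \<open>Signed permutations\<close>

lemma hyperoctahedral_odd: "w \<in> hyperoctahedral n \<Longrightarrow> w (- i) = - w i"
  by (simp add: hyperoctahedral_def)

lemma hyperoctahedral_zero: "w \<in> hyperoctahedral n \<Longrightarrow> w 0 = 0"
  using hyperoctahedral_odd[of w n 0] by simp

lemma hyperoctahedral_inj: "w \<in> hyperoctahedral n \<Longrightarrow> inj w"
  by (auto simp: hyperoctahedral_def permutes_inj)

lemma hyperoctahedral_bij: "w \<in> hyperoctahedral n \<Longrightarrow> bij w"
  by (auto simp: hyperoctahedral_def permutes_bij)

lemma hyperoctahedral_abs_le:
  "w \<in> hyperoctahedral n \<Longrightarrow> \<bar>w i\<bar> \<le> int n \<longleftrightarrow> \<bar>i\<bar> \<le> int n"
  using permutes_in_image[of w "{- int n..int n}" i]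
  by (auto simp: hyperoctahedral_def abs_le_iff)

lemma hyperoctahedral_fix: "w \<in> hyperoctahedral n \<Longrightarrow> \<bar>i\<bar> > int n \<Longrightarrow> w i = i"
  using permutes_not_in[of w "{- int n..int n}" i]
  by (simp add: hyperoctahedral_def abs_if split: if_splits)

lemma hyperoctahedral_mono: "m \<le> n \<Longrightarrow> hyperoctahedral m \<subseteq> hyperoctahedral n"
  by (auto simp: hyperoctahedral_def elim!: permutes_subset)

lemma finite_hyperoctahedral: "finite (hyperoctahedral n)"
  by (rule finite_subset[OF _ finite_permutations[of "{- int n..int n}"]])
    (auto simp: hyperoctahedral_def)

lemma id_hyperoctahedral: "id \<in> hyperoctahedral n"
  by (simp add: hyperoctahedral_def permutes_id)

lemma hyperoctahedral_inv:
  assumes "w \<in> hyperoctahedral n"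
  shows "inv w \<in> hyperoctahedral n"
proof -
  have "inv w (- i) = - inv w i" for i
    using hyperoctahedral_bij[OF assms] hyperoctahedral_odd[OF assms]
    by (metis bij_inv_eq_iff)
  then show ?thesis
    using assms by (auto simp: hyperoctahedral_def permutes_inv)
qed

lemma hyperoctahedral_Suc_fixing:
  assumes "w \<in> hyperoctahedral (Suc n)" "w (int n + 1) = int n + 1"
  shows "w \<in> hyperoctahedral n"
proof -
  have p: "w permutes {- int (Suc n)..int (Suc n)}" using assms(1) by (simp add: hyperoctahedral_def)
  have "w x = x" if "x \<in> {- int (Suc n)..int (Suc n)} - {- int n..int n}" for x
  proof -
    have "x = int n + 1 \<or> x = - (int n + 1)" using that by auto
    then show ?thesis using assms(2) hyperoctahedral_odd[OF assms(1)] by metis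
  qed
  then have "w permutes {- int n..int n}" using permutes_superset[OF p] by blast
  then show ?thesis using assms(1) by (simp add: hyperoctahedral_def)
qed

section \<open>The length function\<close>

text \<open>
  The pairs \<open>(i, j)\<close> with \<open>\<bar>i\<bar> < j\<close> stand for the positive roots, those with \<open>i = 0\<close> for the
  short ones. The short roots made negative by \<open>w\<close> are counted by \<open>neg_positions\<close>, the long ones
  by \<open>long_inversions\<close>.
\<close>

definition long_inversions :: "(int \<Rightarrow> int) \<Rightarrow> (int \<times> int) set" where
  "long_inversions w = {(i, j). i \<noteq> 0 \<and> \<bar>i\<bar> < j \<and> w j < w i}"

definition neg_positions :: "(int \<Rightarrow> int) \<Rightarrow> int set" where
  "neg_positions w = {i. 0 < i \<and> w i < 0}"

text \<open>For \<open>j > n\<close> the value \<open>w j = j\<close> exceeds every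
  \<open>w i\<close> with \<open>\<bar>i\<bar> < j\<close>, so an inversion has both entries between
  \<open>- n\<close> and \<open>n\<close>.\<close>

lemma finite_long_inversions:
  assumes "w \<in> hyperoctahedral n"
  shows "finite (long_inversions w)"
proof (rule finite_subset)
  show "long_inversions w \<subseteq> {- int n..int n} \<times> {- int n..int n}"
  proof clarify
    fix i j assume "(i, j) \<in> long_inversions w"
    then have ij: "\<bar>i\<bar> < j" "w j < w i" by (auto simp: long_inversions_def)
    have "j \<le> int n"
    proof (rule ccontr)
      assume "\<not> j \<le> int n"
      then show False
        using ij hyperoctahedral_fix[OF assms, of j] hyperoctahedral_fix[OF assms, of i]
          hyperoctahedral_abs_le[OF assms, of i] by linarith
    qed
    then show "i \<in> {- int n..int n} \<and> j \<in> {- int n..int n}" using ij by auto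
  qed
qed simp

lemma neg_positions_subset:
  assumes "w \<in> hyperoctahedral n"
  shows "neg_positions w \<subseteq> {1..int n}"
proof
  fix i assume "i \<in> neg_positions w"
  then show "i \<in> {1..int n}"
    using hyperoctahedral_fix[OF assms, of i] by (cases "int n < i") (auto simp: neg_positions_def)
qed

lemma finite_neg_positions: "w \<in> hyperoctahedral n \<Longrightarrow> finite (neg_positions w)"
  using neg_positions_subset finite_subset by blast

lemma neg_count_eq_card: "w \<in> hyperoctahedral n \<Longrightarrow> neg_count n w = card (neg_positions w)"
  using neg_positions_subset[of w n] unfolding neg_count_def
  by (intro arg_cong[of _ _ card]) (auto simp: neg_positions_def)

lemma cox_gen_cancel: "w \<circ> cox_gen k \<circ> cox_gen k = w"
  by (simp add: comp_assoc cox_gen_invol)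

section \<open>Effect of a generator on the short and the long roots\<close>

text \<open>For \<open>k > 0\<close> the generator permutes the positive integers, so it only
  relocates the negative values.\<close>

lemma card_neg_positions_cox_gen:
  assumes k: "0 < k"
  shows "card (neg_positions (w \<circ> cox_gen k)) = card (neg_positions w)"
proof -
  have "neg_positions (w \<circ> cox_gen k) = cox_gen k ` neg_positions w"
  proof (intro set_eqI iffI)
    fix x assume "x \<in> neg_positions (w \<circ> cox_gen k)"
    then show "x \<in> cox_gen k ` neg_positions w"
      using k by (intro image_eqI[of _ _ "cox_gen k x"])
        (auto simp: neg_positions_def cox_gen_pos split: if_splits)
  qed (use k in \<open>auto simp: neg_positions_def cox_gen_pos\<close>)
  moreover have "inj (cox_gen k)" using cox_gen_invol[of k] by (metis inj_on_id inj_on_imageI2)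
  ultimately show ?thesis by (simp add: card_image inj_on_subset)
qed

text \<open>A simple reflection permutes the positive roots other than its own. That one, the pair
  \<open>(k, k + 1)\<close>, is inverted by \<open>w \<circ> cox_gen k\<close> but not by
  \<open>w\<close>.\<close>

lemma card_long_inversions_cox_gen_ascent:
  assumes w: "w \<in> hyperoctahedral n" and k: "0 < k" and asc: "w (int k) < w (int k + 1)"
  shows "card (long_inversions (w \<circ> cox_gen k)) = Suc (card (long_inversions w))"
proof -
  let ?s = "cox_gen k"
  txt \<open>The reflection \<open>?s\<close> sends the root of \<open>(- k, k + 1)\<close> to itself, but the pair to the
    other representative \<open>(- (k + 1), k)\<close>.\<close>
  define \<tau> where "\<tau> = (\<lambda>(i, j). if (i, j) = (- int k, int k + 1) then (i, j) else (?s i, ?s j))"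
  define P where "P = {(i, j). i \<noteq> 0 \<and> \<bar>i\<bar> < j \<and> (i, j) \<noteq> (int k, int k + 1)}"
  have odd: "w (- 1 - int k) = - w (int k + 1)" "w (- int k) = - w (int k)"
    using hyperoctahedral_odd[OF w, of "int k + 1"] hyperoctahedral_odd[OF w, of "int k"]
    by (simp_all add: algebra_simps)
  have odd': "w (- int k - 1) = - w (int k + 1)"
    using hyperoctahedral_odd[OF w, of "int k + 1"] by simp
  \<comment> \<open>On \<open>P\<close>, the map \<open>\<tau>\<close> is an involution matching
    inversions of \<open>w \<circ> ?s\<close> with those of \<open>w\<close>.\<close>
  have \<tau>: "\<tau> p \<in> P \<and> \<tau> (\<tau> p) = p \<and> (\<tau> p \<in> long_inversions w \<longleftrightarrow> p \<in> long_inversions (w \<circ> ?s))"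
    if "p \<in> P" for p
  proof -
    obtain i j where "p = (i, j)" by fastforce
    with that have p: "p = (i, j)" "i \<noteq> 0" "\<bar>i\<bar> < j" "(i, j) \<noteq> (int k, int k + 1)"
      by (simp_all add: P_def)
    consider "j < int k" | "j = int k" | "j = int k + 1" "i = - int k"
      | "j = int k + 1" "\<bar>i\<bar> < int k" | "j > int k + 1"
      using p by fastforce
    then show ?thesis
    proof cases
      case 1
      then have "?s i = i" "?s j = j" using p by (auto simp: cox_gen_pos[OF k])
      then show ?thesis using 1 p by (auto simp: \<tau>_def P_def long_inversions_def)
    next
      case 2
      then have "?s i = i" "?s j = int k + 1" "?s (int k + 1) = int k"
        using p by (auto simp: cox_gen_pos[OF k])
      then show ?thesis using 2 p by (auto simp: \<tau>_def P_def long_inversions_def)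
    next
      \<comment> \<open>This is the pair fixed by \<open>\<tau>\<close>; by oddness it is an
        inversion of either map exactly when \<open>w k + w (k + 1) < 0\<close>.\<close>
      case 3
      then show ?thesis
        using p odd odd' k by (auto simp: \<tau>_def P_def long_inversions_def cox_gen_pos[OF k])
    next
      case 4
      then have "?s i = i" "?s j = int k" "?s (int k) = int k + 1"
        using p by (auto simp: cox_gen_pos[OF k])
      then show ?thesis using 4 p by (auto simp: \<tau>_def P_def long_inversions_def)
    next
      case 5
      then have "?s j = j" "?s i \<noteq> 0" "\<bar>?s i\<bar> < j"
        using p k by (auto simp: cox_gen_pos[OF k])
      moreover have "?s (?s i) = i" using cox_gen_invol[of k] by (metis comp_apply id_apply)
      ultimately show ?thesis using 5 p by (auto simp: \<tau>_def P_def long_inversions_def)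
    qed
  qed
  have sub: "long_inversions w \<subseteq> P" "long_inversions (w \<circ> ?s) - {(int k, int k + 1)} \<subseteq> P"
    using asc by (auto simp: long_inversions_def P_def)
  have simple: "(int k, int k + 1) \<in> long_inversions (w \<circ> ?s)"
    using asc k by (simp add: long_inversions_def cox_gen_pos)
  have "long_inversions (w \<circ> ?s) - {(int k, int k + 1)} = \<tau> ` long_inversions w"
  proof (intro set_eqI iffI)
    fix p assume "p \<in> long_inversions (w \<circ> ?s) - {(int k, int k + 1)}"
    then show "p \<in> \<tau> ` long_inversions w" using \<tau> sub(2) by (metis DiffD1 image_eqI subsetD)
  next
    fix p assume "p \<in> \<tau> ` long_inversions w"
    then obtain r where r: "r \<in> long_inversions w" "p = \<tau> r" by blast
    then have "p \<in> P" "\<tau> p = r" using \<tau>[of r] sub(1) by auto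
    then show "p \<in> long_inversions (w \<circ> ?s) - {(int k, int k + 1)}"
      using \<tau>[of p] r(1) by (auto simp: P_def)
  qed
  then have "long_inversions (w \<circ> ?s) = insert (int k, int k + 1) (\<tau> ` long_inversions w)"
    using simple by blast
  moreover have "(int k, int k + 1) \<notin> \<tau> ` long_inversions w"
    using \<tau> sub(1) by (force simp: P_def)
  moreover have "inj_on \<tau> (long_inversions w)"
    using \<tau> sub(1) by (intro inj_on_inverseI[of _ \<tau>]) blast
  ultimately show ?thesis by (simp add: card_image finite_long_inversions[OF w])
qed

text \<open>A nonzero \<open>i\<close> with \<open>\<bar>i\<bar> < j\<close> forces
  \<open>j \<ge> 2\<close>, so \<open>cox_gen 0\<close> fixes the second entry of each pair and at
  most changes the sign of the first.\<close>

lemma card_long_inversions_cox_gen_0: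
  assumes w: "w \<in> hyperoctahedral n"
  shows "card (long_inversions (w \<circ> cox_gen 0)) = card (long_inversions w)"
proof -
  let ?\<tau> = "\<lambda>(i, j). (cox_gen 0 i, j)"
  have s0: "cox_gen 0 (cox_gen 0 i) = i" "cox_gen 0 i = 0 \<longleftrightarrow> i = 0" "\<bar>cox_gen 0 i\<bar> = \<bar>i\<bar>" for i
    by (auto simp: cox_gen_0)
  have s0_fix: "cox_gen 0 j = j" if "i \<noteq> 0" "\<bar>i\<bar> < j" for i j
    using that by (auto simp: cox_gen_0)
  have "long_inversions (w \<circ> cox_gen 0) = ?\<tau> ` long_inversions w"
  proof (intro set_eqI iffI)
    fix p assume "p \<in> long_inversions (w \<circ> cox_gen 0)"
    then show "p \<in> ?\<tau> ` long_inversions w"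
      by (intro image_eqI[of _ _ "?\<tau> p"]) (auto simp: long_inversions_def s0 s0_fix)
  qed (auto simp: long_inversions_def s0 s0_fix)
  moreover have "inj_on ?\<tau> (long_inversions w)"
    by (rule inj_on_inverseI[of _ ?\<tau>]) (auto simp: s0)
  ultimately show ?thesis by (simp add: card_image)
qed

lemma card_neg_positions_cox_gen_0_ascent:
  assumes w: "w \<in> hyperoctahedral n" and asc: "0 < w 1"
  shows "card (neg_positions (w \<circ> cox_gen 0)) = Suc (card (neg_positions w))"
proof -
  have "neg_positions (w \<circ> cox_gen 0) = insert 1 (neg_positions w)"
    using asc hyperoctahedral_odd[OF w, of 1]
    by (auto simp: neg_positions_def cox_gen_0 split: if_splits)
  moreover have "1 \<notin> neg_positions w" using asc by (simp add: neg_positions_def)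
  ultimately show ?thesis by (simp add: finite_neg_positions[OF w])
qed

section \<open>Coxeter length and descents in terms of roots\<close>

text \<open>The number of positive roots made negative; \<open>cox_length_eq\<close> identifies it
  with the Coxeter length.\<close>

definition root_count :: "(int \<Rightarrow> int) \<Rightarrow> nat" where
  "root_count w = card (long_inversions w) + card (neg_positions w)"

text \<open>The condition is uniform in \<open>k\<close>: as \<open>w 0 = 0\<close>, an ascent at
  \<open>0\<close> means \<open>0 < w 1\<close>.\<close>

lemma root_count_ascent:
  assumes "w \<in> hyperoctahedral n" and "w (int k) < w (int k + 1)"
  shows "root_count (w \<circ> cox_gen k) = Suc (root_count w)"
  using assms hyperoctahedral_zero[OF assms(1)]
  by (cases "k = 0") (simp_all add: root_count_def card_neg_positions_cox_gen
      card_long_inversions_cox_gen_ascent card_long_inversions_cox_gen_0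
      card_neg_positions_cox_gen_0_ascent)

text \<open>Composing with \<open>cox_gen k\<close> turns the descent into an ascent, and
  \<open>cox_gen k\<close> is its own inverse.\<close>

lemma root_count_descent:
  assumes w: "w \<in> hyperoctahedral n" and k: "k < n" and desc: "w (int k + 1) < w (int k)"
  shows "root_count w = Suc (root_count (w \<circ> cox_gen k))"
proof -
  have "w \<circ> cox_gen k \<in> hyperoctahedral n" using w cox_gen_in[OF k] by (rule hyperoctahedral_comp)
  moreover have "(w \<circ> cox_gen k) (int k) < (w \<circ> cox_gen k) (int k + 1)"
    using desc hyperoctahedral_odd[OF w, of 1] hyperoctahedral_zero[OF w]
    by (cases "k = 0") (simp_all add: cox_gen_0 cox_gen_pos)
  ultimately show ?thesis using root_count_ascent by (metis cox_gen_cancel)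
qed

lemma hyperoctahedral_ascent_or_descent:
  "w \<in> hyperoctahedral n \<Longrightarrow> w (i + 1) < w i \<or> w i < w (i + 1)"
  using inj_eq[OF hyperoctahedral_inj, of w n "i + 1" i] by linarith

text \<open>Each letter changes the count by exactly one, up or down, so no word is shorter than the
  root count of its product.\<close>

lemma root_count_cox_word_le:
  "set is \<subseteq> {..<n} \<Longrightarrow> cox_word is \<in> hyperoctahedral n \<and> root_count (cox_word is) \<le> length is"
proof (induction "is" rule: rev_induct)
  case Nil
  have "long_inversions id = {}" "neg_positions id = {}"
    by (auto simp: long_inversions_def neg_positions_def)
  then have "root_count id = 0" by (simp only: root_count_def card.empty add_0)
  moreover have "cox_word [] = id" by (simp add: cox_word_def)
  ultimately show ?case by (metis id_hyperoctahedral le0)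
next
  case (snoc i xs)
  then have i: "i < n" and w: "cox_word xs \<in> hyperoctahedral n"
    and le: "root_count (cox_word xs) \<le> length xs" by auto
  have eq: "cox_word (xs @ [i]) = cox_word xs \<circ> cox_gen i"
    unfolding cox_word_append by (simp add: cox_word_def)
  have "root_count (cox_word xs \<circ> cox_gen i) \<le> Suc (root_count (cox_word xs))"
    using hyperoctahedral_ascent_or_descent[OF w, of "int i"]
      root_count_ascent[OF w, of i] root_count_descent[OF w i] by linarith
  then show ?case
    using le hyperoctahedral_comp[OF w cox_gen_in[OF i]] unfolding eq length_append_singleton
    by (meson Suc_le_mono le_trans)
qed

text \<open>Sorting: removing a descent lowers the count by one, and an element without descents is
  the identity.\<close>

lemma cox_word_of_root_count:
  "w \<in> hyperoctahedral n \<Longrightarrow>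
    \<exists>is. length is \<le> root_count w \<and> set is \<subseteq> {..<n} \<and> cox_word is = w"
proof (induction "root_count w" arbitrary: w rule: less_induct)
  case less
  show ?case
  proof (cases "\<exists>i<n. w (int i + 1) < w (int i)")
    case True
    then obtain i where i: "i < n" and "w (int i + 1) < w (int i)" by blast
    then have rc: "root_count w = Suc (root_count (w \<circ> cox_gen i))"
      using root_count_descent less.prems by blast
    then obtain xs where "length xs \<le> root_count (w \<circ> cox_gen i)" "set xs \<subseteq> {..<n}"
      "cox_word xs = w \<circ> cox_gen i"
      using less.hyps[of "w \<circ> cox_gen i"] hyperoctahedral_comp[OF less.prems cox_gen_in[OF i]]
      by auto
    moreover have "cox_word (xs @ [i]) = cox_word xs \<circ> cox_gen i"
      unfolding cox_word_append by (simp add: cox_word_def)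
    ultimately show ?thesis
      using rc i by (intro exI[of _ "xs @ [i]"]) (simp add: cox_gen_cancel)
  next
    case False
    then have asc: "w (int i) < w (int i + 1)" if "i < n" for i
      using hyperoctahedral_ascent_or_descent[OF less.prems] that by blast
    have "w = id"
      using asc[of 0] asc hyperoctahedral_zero[OF less.prems]
      by (intro hyperoctahedral_no_descent_id[OF less.prems]) simp_all
    then show ?thesis by (intro exI[of _ "[]"]) (simp add: cox_word_def)
  qed
qed

lemma cox_length_eq:
  assumes w: "w \<in> hyperoctahedral n"
  shows "cox_length n w = card (long_inversions w) + card (neg_positions w)"
proof (rule antisym)
  from cox_word_of_root_count[OF w] obtain xs where xs: "length xs \<le> root_count w"
    "set xs \<subseteq> {..<n}" "cox_word xs = w" by blast
  then have "cox_length n w \<le> length xs" unfolding cox_length_def by (intro Least_le) blast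
  with xs(1) show "cox_length n w \<le> card (long_inversions w) + card (neg_positions w)"
    by (simp add: root_count_def)
  have "\<exists>k is. length is = k \<and> set is \<subseteq> {..<n} \<and> cox_word is = w" using xs by blast
  from LeastI_ex[OF this] obtain ys where "length ys = cox_length n w" "set ys \<subseteq> {..<n}"
    "cox_word ys = w" unfolding cox_length_def by blast
  then show "card (long_inversions w) + card (neg_positions w) \<le> cox_length n w"
    using root_count_cox_word_le[of ys n] by (simp add: root_count_def)
qed

text \<open>The length is the root count, which rises at an ascent and falls at a descent; equal
  neighbours do not occur.\<close>

lemma descents_eq:
  assumes w: "w \<in> hyperoctahedral n"
  shows "descents n w = {i. i < n \<and> w (int i + 1) < w (int i)}"
proof -
  have "cox_length n (w \<circ> cox_gen i) < cox_length n w \<longleftrightarrow> w (int i + 1) < w (int i)"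
    if i: "i < n" for i
    using cox_length_eq[OF w] cox_length_eq[OF hyperoctahedral_comp[OF w cox_gen_in[OF i]]]
      hyperoctahedral_ascent_or_descent[OF w, of "int i"]
      root_count_ascent[OF w, of i] root_count_descent[OF w i]
    unfolding root_count_def by linarith
  then show ?thesis by (auto simp: descents_def)
qed

lemma parabolic_quotient_eq:
  "parabolic_quotient n I =
    {w \<in> hyperoctahedral n. \<forall>i<n. i \<notin> I \<longrightarrow> w (int i) < w (int i + 1)}"
  unfolding parabolic_quotient_def
  by (rule Collect_cong, rule conj_cong[OF refl], simp add: descents_eq)
    (smt (verit, best) hyperoctahedral_ascent_or_descent mem_Collect_eq subset_iff)

section \<open>Parabolic factorisation\<close>

text \<open>The bivariate length monomial. It does not mention \<open>n\<close>, so an element keeps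
  its weight when \<open>B_m\<close> is embedded in \<open>B_n\<close>.\<close>

definition weight :: "'a::comm_semiring_1 \<Rightarrow> 'a \<Rightarrow> (int \<Rightarrow> int) \<Rightarrow> 'a" where
  "weight q t w = t ^ card (neg_positions w) * q ^ card (long_inversions w)"

text \<open>Without descents below \<open>m\<close>, \<open>u\<close> increases on
  \<open>0, ..., m\<close>; oddness and \<open>u 0 = 0\<close> extend this to
  \<open>- m, ..., m\<close>.\<close>

lemma hyperoctahedral_less_iff:
  assumes u: "u \<in> hyperoctahedral n" and asc: "\<And>i. i < m \<Longrightarrow> u (int i) < u (int i + 1)"
    and xy: "\<bar>x\<bar> \<le> int m" "\<bar>y\<bar> \<le> int m"
  shows "u x < u y \<longleftrightarrow> x < y"
proof -
  have nats: "a + Suc d \<le> m \<Longrightarrow> u (int a) < u (int (a + Suc d))" for a d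
  proof (induction d)
    case 0
    then show ?case using asc[of a] by (simp add: add.commute)
  next
    case (Suc d)
    then have "u (int a) < u (int (a + Suc d))" by simp
    also have "\<dots> < u (int (a + Suc d) + 1)" using Suc.prems by (intro asc) simp
    also have "int (a + Suc d) + 1 = int (a + Suc (Suc d))" by simp
    finally show ?case .
  qed
  have nonneg: "u a < u b" if "0 \<le> a" "a < b" "b \<le> int m" for a b
    using nats[of "nat a" "nat (b - a - 1)"] that by (simp add: nat_diff_distrib)
  have mono: "u a < u b" if ab: "a < b" "\<bar>a\<bar> \<le> int m" "\<bar>b\<bar> \<le> int m" for a b
  proof -
    consider "0 \<le> a" | "b \<le> 0" | "a < 0" "0 < b" by linarith
    then show ?thesis
    proof cases
      case 1
      then show ?thesis using nonneg ab by simp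
    next
      case 2
      then show ?thesis
        using nonneg[of "- b" "- a"] ab hyperoctahedral_odd[OF u] by simp
    next
      case 3
      then show ?thesis
        using nonneg[of 0 "- a"] nonneg[of 0 b] ab hyperoctahedral_odd[OF u]
          hyperoctahedral_zero[OF u] by simp
    qed
  qed
  show ?thesis using mono[of x y] mono[of y x] xy by (metis less_irrefl linorder_neqE less_trans)
qed

text \<open>\<open>v\<close> permutes \<open>- m, ..., m\<close>, where \<open>u\<close> preserves
  order, and fixes everything beyond. So roots with largest entry at most \<open>m\<close> are
  inverted by \<open>u \<circ> v\<close> as by \<open>v\<close>, and the others as by
  \<open>u\<close>, after relabelling the first entry by \<open>v\<close>.\<close>

lemma weight_comp:
  assumes u: "u \<in> hyperoctahedral n" and asc: "\<And>i. i < m \<Longrightarrow> u (int i) < u (int i + 1)"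
    and v: "v \<in> hyperoctahedral m"
  shows "weight q t (u \<circ> v) = weight q t u * weight q t v"
proof -
  have less_iff: "u x < u y \<longleftrightarrow> x < y" if "\<bar>x\<bar> \<le> int m" "\<bar>y\<bar> \<le> int m" for x y
    by (rule hyperoctahedral_less_iff[OF u asc that])
  note v_le = hyperoctahedral_abs_le[OF v] and v_fix = hyperoctahedral_fix[OF v]
  have v0: "v i = 0 \<longleftrightarrow> i = 0" for i
    using inj_eq[OF hyperoctahedral_inj[OF v], of i 0] hyperoctahedral_zero[OF v] by simp
  have v_less: "\<bar>v i\<bar> < j \<longleftrightarrow> \<bar>i\<bar> < j" if "int m < j" for i j
    using v_le[of i] v_fix[of i] that by (cases "\<bar>i\<bar> \<le> int m") auto
  define \<phi> where "\<phi> = (\<lambda>(i::int, j::int). (v i, j))"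
  have long_u: "int m < j" if "(i, j) \<in> long_inversions u" for i j
    using that less_iff[of j i] by (force simp: long_inversions_def)
  have long_v: "j \<le> int m" if "(i, j) \<in> long_inversions v" for i j
    using that v_fix[of j] v_less[of j i] by (force simp: long_inversions_def)
  have long: "long_inversions (u \<circ> v) = long_inversions v \<union> \<phi> -` long_inversions u"
  proof (intro set_eqI)
    fix p :: "int \<times> int"
    obtain i j where p: "p = (i, j)" by fastforce
    show "p \<in> long_inversions (u \<circ> v) \<longleftrightarrow> p \<in> long_inversions v \<union> \<phi> -` long_inversions u"
    proof (cases "int m < j")
      case True
      then have "v j = j \<or> j < 0" using v_fix[of j] by auto
      then show ?thesis
        using True p long_v[of i j] v0[of i] v_less[of j i]
        by (auto simp: \<phi>_def long_inversions_def)
    next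
      case False
      then have "\<bar>i\<bar> < j \<Longrightarrow> u (v j) < u (v i) \<longleftrightarrow> v j < v i"
        using v_le[of i] v_le[of j] by (intro less_iff) auto
      moreover have "p \<notin> \<phi> -` long_inversions u"
        using long_u[of "v i" j] False p by (auto simp: \<phi>_def)
      ultimately show ?thesis using p by (auto simp: long_inversions_def)
    qed
  qed
  have \<phi>: "inj \<phi>" "long_inversions u \<subseteq> range \<phi>"
  proof -
    show "inj \<phi>" using hyperoctahedral_inj[OF v] by (auto simp: \<phi>_def inj_def)
    show "long_inversions u \<subseteq> range \<phi>"
    proof clarify
      fix i j assume "(i, j) \<in> long_inversions u"
      have "\<phi> (inv v i, j) = (i, j)"
        using bij_is_surj[OF hyperoctahedral_bij[OF v]] by (simp add: \<phi>_def surj_f_inv_f)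
      then show "(i, j) \<in> range \<phi>" by (metis rangeI)
    qed
  qed
  have "long_inversions v \<inter> \<phi> -` long_inversions u = {}"
    using long_u long_v by (force simp: \<phi>_def)
  then have card_long: "card (long_inversions (u \<circ> v)) = card (long_inversions v) + card (long_inversions u)"
    unfolding long using finite_long_inversions[OF u] finite_long_inversions[OF v] \<phi>
    by (simp add: card_Un_disjoint card_vimage_inj finite_vimageI)
  have neg_u: "int m < i" if "i \<in> neg_positions u" for i
    using that less_iff[of i 0] hyperoctahedral_zero[OF u] by (force simp: neg_positions_def)
  have neg_v: "i \<le> int m" if "i \<in> neg_positions v" for i
    using neg_positions_subset[OF v] that by auto
  have "neg_positions (u \<circ> v) = neg_positions v \<union> neg_positions u"
  proof (intro set_eqI)
    fix i
    show "i \<in> neg_positions (u \<circ> v) \<longleftrightarrow> i \<in> neg_positions v \<union> neg_positions u"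
    proof (cases "int m < i")
      case True
      then show ?thesis using v_fix[of i] by (auto simp: neg_positions_def)
    next
      case False
      then have "0 < i \<Longrightarrow> u (v i) < u 0 \<longleftrightarrow> v i < 0"
        using v_le[of i] by (intro less_iff) auto
      then show ?thesis
        using False neg_u[of i] hyperoctahedral_zero[OF u] by (auto simp: neg_positions_def)
    qed
  qed
  moreover have "neg_positions v \<inter> neg_positions u = {}" using neg_u neg_v by force
  ultimately have "card (neg_positions (u \<circ> v)) = card (neg_positions v) + card (neg_positions u)"
    using finite_neg_positions[OF u] finite_neg_positions[OF v] by (simp add: card_Un_disjoint)
  then show ?thesis using card_long by (simp add: weight_def power_add mult_ac)
qed

text \<open>\<open>u\<close> is the minimal representative of a coset of \<open>B_m\<close>: it
  increases on \<open>0, ..., m\<close>, so the descents of \<open>u \<circ> v\<close> below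
  \<open>m\<close> are those of \<open>v\<close>, while above \<open>m\<close> it agrees with
  \<open>u\<close>.\<close>

lemma bij_betw_parabolic_factorisation:
  assumes m: "m < n" and I: "I \<subseteq> {..<m}"
  shows "bij_betw (\<lambda>(u, v). u \<circ> v) (parabolic_quotient n {m} \<times> parabolic_quotient m I)
           (parabolic_quotient n (insert m I))"
proof (rule bij_betwI')
  fix p p' assume "p \<in> parabolic_quotient n {m} \<times> parabolic_quotient m I"
    "p' \<in> parabolic_quotient n {m} \<times> parabolic_quotient m I"
  then obtain u v u' v' where p: "p = (u, v)" "p' = (u', v')"
    and u: "u \<in> hyperoctahedral n" "\<And>i. i < m \<Longrightarrow> u (int i) < u (int i + 1)"
    and u': "u' \<in> hyperoctahedral n" "\<And>i. i < m \<Longrightarrow> u' (int i) < u' (int i + 1)"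
    and v: "v \<in> hyperoctahedral m" and v': "v' \<in> hyperoctahedral m"
    using m by (auto simp: parabolic_quotient_eq)
  have "u = u' \<and> v = v'" if eq: "u \<circ> v = u' \<circ> v'"
  proof -
    \<comment> \<open>The two factorisations differ by \<open>x\<close> in \<open>B_m\<close>. Both
      \<open>u\<close> and \<open>u \<circ> x\<close> increase up to \<open>m\<close>, so
      \<open>x\<close> has no descent and is the identity.\<close>
    define x where "x = v \<circ> inv v'"
    have x: "x \<in> hyperoctahedral m"
      unfolding x_def using v v' by (intro hyperoctahedral_comp hyperoctahedral_inv)
    have ux: "u \<circ> x = u'"
      using eq bij_is_surj[OF hyperoctahedral_bij[OF v']]
      by (simp add: x_def surj_iff comp_assoc flip: comp_assoc[of u v])
    have "x (int i) < x (int i + 1)" if "i < m" for i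
    proof -
      have "u (x (int i)) < u (x (int i + 1))" using u'(2)[OF that] ux by auto
      then show ?thesis
        using hyperoctahedral_less_iff[OF u] hyperoctahedral_abs_le[OF x] that by simp
    qed
    from this[of 0] this have "x = id"
      using hyperoctahedral_zero[OF x] by (intro hyperoctahedral_no_descent_id[OF x]) simp_all
    then have "u = u'" "v = v'"
      using ux eq inj_eq[OF hyperoctahedral_inj[OF u(1)]] by (auto simp: fun_eq_iff)
    then show ?thesis ..
  qed
  then show "((\<lambda>(u, v). u \<circ> v) p = (\<lambda>(u, v). u \<circ> v) p') = (p = p')" using p by auto
next
  fix p assume "p \<in> parabolic_quotient n {m} \<times> parabolic_quotient m I"
  then obtain u v where p: "p = (u, v)"
    and u: "u \<in> hyperoctahedral n" "\<And>i. i < n \<Longrightarrow> i \<noteq> m \<Longrightarrow> u (int i) < u (int i + 1)"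
    and v: "v \<in> hyperoctahedral m" "\<And>i. i < m \<Longrightarrow> i \<notin> I \<Longrightarrow> v (int i) < v (int i + 1)"
    by (auto simp: parabolic_quotient_eq)
  have "u (v (int i)) < u (v (int i + 1))" if i: "i < n" "i \<notin> insert m I" for i
  proof (cases "i < m")
    case True
    then have "u (v (int i)) < u (v (int i + 1)) \<longleftrightarrow> v (int i) < v (int i + 1)"
      using u m hyperoctahedral_abs_le[OF v(1)] by (intro hyperoctahedral_less_iff[of u n m]) auto
    then show ?thesis using True v(2) i by simp
  next
    case False
    then show ?thesis using i u(2)[of i] hyperoctahedral_fix[OF v(1)] by simp
  qed
  moreover have "u \<circ> v \<in> hyperoctahedral n"
    using u(1) v(1) hyperoctahedral_mono[of m n] m by (intro hyperoctahedral_comp) auto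
  ultimately show "(\<lambda>(u, v). u \<circ> v) p \<in> parabolic_quotient n (insert m I)"
    by (simp add: p parabolic_quotient_eq)
next
  txt \<open>The minimal length representative of the coset of \<open>w\<close> has no descents below \<open>m\<close>.\<close>
  fix w assume "w \<in> parabolic_quotient n (insert m I)"
  then have w: "w \<in> hyperoctahedral n"
    "\<And>i. i < n \<Longrightarrow> i \<noteq> m \<Longrightarrow> i \<notin> I \<Longrightarrow> w (int i) < w (int i + 1)"
    by (auto simp: parabolic_quotient_eq)
  obtain x where x: "x \<in> hyperoctahedral m"
    and min: "\<And>y. y \<in> hyperoctahedral m \<Longrightarrow> root_count (w \<circ> x) \<le> root_count (w \<circ> y)"
    using ex_has_least_nat[of "\<lambda>x. x \<in> hyperoctahedral m" id "\<lambda>x. root_count (w \<circ> x)"]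
      id_hyperoctahedral by blast
  define u v where "u = w \<circ> x" and "v = inv x"
  have u: "u \<in> hyperoctahedral n"
    unfolding u_def using w(1) x hyperoctahedral_mono[of m n] m
    by (intro hyperoctahedral_comp) auto
  have v: "v \<in> hyperoctahedral m" unfolding v_def using x by (rule hyperoctahedral_inv)
  have uv: "u \<circ> v = w"
    using bij_is_surj[OF hyperoctahedral_bij[OF x]] by (simp add: u_def v_def comp_assoc surj_iff)
  have u_low: "u (int i) < u (int i + 1)" if i: "i < m" for i
  proof (rule ccontr)
    assume "\<not> ?thesis"
    then have "root_count u = Suc (root_count (u \<circ> cox_gen i))"
      using hyperoctahedral_ascent_or_descent[OF u] root_count_descent[OF u] i m
      by (meson less_trans)
    \<comment> \<open>With \<open>x\<close> also \<open>x \<circ> cox_gen i\<close> lies in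
      \<open>B_m\<close>, so the minimality of \<open>x\<close> applies to it.\<close>
    moreover have "root_count u \<le> root_count (u \<circ> cox_gen i)"
      using min[OF hyperoctahedral_comp[OF x cox_gen_in[OF i]]] by (simp add: u_def comp_assoc)
    ultimately show False by simp
  qed
  \<comment> \<open>Beyond \<open>m\<close> the map \<open>x\<close> is the identity, and
    \<open>I\<close> has no elements there, so \<open>u\<close> inherits the ascents of
    \<open>w\<close>.\<close>
  have u_high: "u (int i) < u (int i + 1)" if "i < n" "m < i" for i
    using w(2)[of i] that I hyperoctahedral_fix[OF x] by (force simp: u_def)
  have "u \<in> parabolic_quotient n {m}"
    using u u_low u_high by (auto simp: parabolic_quotient_eq dest: linorder_neqE_nat)
  moreover have "v (int i) < v (int i + 1)" if "i < m" "i \<notin> I" for i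
  proof -
    have "u (v (int i)) < u (v (int i + 1))"
      using w(2)[of i] that m by (simp flip: uv)
    then show ?thesis
      using hyperoctahedral_less_iff[OF u u_low] hyperoctahedral_abs_le[OF v] that by simp
  qed
  then have "v \<in> parabolic_quotient m I" using v by (simp add: parabolic_quotient_eq)
  ultimately show "\<exists>p\<in>parabolic_quotient n {m} \<times> parabolic_quotient m I. w = (\<lambda>(u, v). u \<circ> v) p"
    using uv by (intro bexI[of _ "(u, v)"]) auto
qed

lemma sum_weight_parabolic_factorisation:
  assumes "m < n" and "I \<subseteq> {..<m}"
  shows "sum (weight q t) (parabolic_quotient n (insert m I)) =
    sum (weight q t) (parabolic_quotient n {m}) * sum (weight q t) (parabolic_quotient m I)"
proof -
  have "sum (weight q t) (parabolic_quotient n (insert m I)) =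
      (\<Sum>(u, v)\<in>parabolic_quotient n {m} \<times> parabolic_quotient m I. weight q t (u \<circ> v))"
    using sum.reindex_bij_betw[OF bij_betw_parabolic_factorisation[OF assms], of "weight q t"]
    by (simp add: case_prod_unfold)
  also have "\<dots> = (\<Sum>(u, v)\<in>parabolic_quotient n {m} \<times> parabolic_quotient m I.
      weight q t u * weight q t v)"
    using assms(1) by (intro sum.cong) (auto simp: parabolic_quotient_eq intro!: weight_comp[where m = m])
  finally show ?thesis by (simp add: sum_product sum.cartesian_product)
qed

section \<open>Maximal parabolic quotients\<close>

text \<open>
  Composing \<open>v \<in> B\<^sub>n\<close> with \<open>insert_max k n\<close> inserts the value \<open>n + 1\<close> at position \<open>k\<close> of the
  window of \<open>v\<close>; composing with \<open>insert_min m n\<close> inserts \<open>-(n + 1)\<close> at position \<open>m + 1\<close>.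
\<close>

definition insert_max :: "nat \<Rightarrow> nat \<Rightarrow> int \<Rightarrow> int" where
  "insert_max k n = cox_word (rev [k..<Suc n])"

primrec insert_min :: "nat \<Rightarrow> nat \<Rightarrow> int \<Rightarrow> int" where
  "insert_min 0 n = insert_max 1 n \<circ> cox_gen 0"
| "insert_min (Suc m) n = insert_min m n \<circ> cox_gen (Suc m)"

lemma insert_max_top: "insert_max (Suc n) n = id"
  by (simp add: insert_max_def cox_word_def)

lemma insert_max_step: "k \<le> n \<Longrightarrow> insert_max k n = insert_max (Suc k) n \<circ> cox_gen k"
  by (simp add: insert_max_def upt_conv_Cons cox_word_append del: upt_Suc) (simp add: cox_word_def)

lemma insert_max_hyperoctahedral: "insert_max k n \<in> hyperoctahedral (Suc n)"
  unfolding insert_max_def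
  by (rule conjunct1[OF root_count_cox_word_le]) (auto simp del: upt_Suc)

lemma insert_min_hyperoctahedral: "m \<le> n \<Longrightarrow> insert_min m n \<in> hyperoctahedral (Suc n)"
  by (induction m) (auto intro!: hyperoctahedral_comp insert_max_hyperoctahedral cox_gen_in)

text \<open>Arguments \<open>j \<ge> 0\<close> suffice, since oddness determines the rest. The
  induction descends from \<open>k = n + 1\<close>, where the map is the identity.\<close>

lemma insert_max_apply:
  assumes "k \<le> Suc n" "0 < k" "0 \<le> j"
  shows "insert_max k n j =
    (if j < int k then j else if j = int k then int n + 1 else if j \<le> int n + 1 then j - 1 else j)"
  using assms
proof (induction k arbitrary: j rule: inc_induct)
  case base
  then show ?case by (simp add: insert_max_top)
next
  case (step k)
  have "0 \<le> cox_gen k j" using step.prems by (simp add: cox_gen_pos)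
  then show ?case
    using step.IH[of "cox_gen k j"] step.hyps step.prems
    by (simp add: insert_max_step) (auto simp: cox_gen_pos)
qed

lemma insert_min_apply:
  assumes "m \<le> n" "0 \<le> j"
  shows "insert_min m n j =
    (if j \<le> int m then j else if j = int m + 1 then - (int n + 1)
     else if j \<le> int n + 1 then j - 1 else j)"
  using assms
proof (induction m arbitrary: j)
  case 0
  have "insert_max 1 n (- 1) = - (int n + 1)"
    using hyperoctahedral_odd[OF insert_max_hyperoctahedral, of 1 n 1] insert_max_apply[of 1 n 1]
    by simp
  then show ?case using 0 insert_max_apply[of 1 n j] by (auto simp: cox_gen_0)
next
  case (Suc m)
  have "0 \<le> cox_gen (Suc m) j" using Suc.prems by (simp add: cox_gen_pos)
  then show ?case
    using Suc.IH[of "cox_gen (Suc m) j"] Suc.prems by simp (auto simp: cox_gen_pos)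
qed

section \<open>Weights of the insertions\<close>

lemma weight_ascent:
  assumes "w \<in> hyperoctahedral n" and "w (int k) < w (int k + 1)"
  shows "weight q t (w \<circ> cox_gen k) = (if k = 0 then t else q) * weight q t w"
  using assms hyperoctahedral_zero[OF assms(1)]
  by (cases "k = 0") (simp_all add: weight_def card_neg_positions_cox_gen
      card_long_inversions_cox_gen_ascent card_long_inversions_cox_gen_0
      card_neg_positions_cox_gen_0_ascent mult_ac)

text \<open>Starting at position \<open>n + 1\<close>, the largest value moves left past
  \<open>n + 1 - k\<close> smaller entries, each an ascent contributing \<open>q\<close>.\<close>

lemma weight_insert_max:
  assumes v: "v \<in> hyperoctahedral n" and k: "k \<le> Suc n" "0 < k"
  shows "weight q t (v \<circ> insert_max k n) = q ^ (Suc n - k) * weight q t v"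
  using k
proof (induction k rule: inc_induct)
  case base
  then show ?case by (simp add: insert_max_top)
next
  case (step k)
  let ?w = "v \<circ> insert_max (Suc k) n"
  have "?w (int k) = v (int k)" "?w (int k + 1) = v (int n + 1)"
    using step.hyps by (simp_all add: insert_max_apply)
  moreover have "v (int n + 1) = int n + 1" "\<bar>v (int k)\<bar> \<le> int n"
    using hyperoctahedral_fix[OF v] hyperoctahedral_abs_le[OF v] step.hyps by simp_all
  moreover have "?w \<in> hyperoctahedral (Suc n)"
    using v hyperoctahedral_mono[of n "Suc n"]
    by (intro hyperoctahedral_comp insert_max_hyperoctahedral) auto
  ultimately have "weight q t (?w \<circ> cox_gen k) = q * weight q t ?w"
    using step.prems by (subst weight_ascent) auto
  moreover have "v \<circ> insert_max k n = ?w \<circ> cox_gen k" "Suc n - k = Suc (Suc n - Suc k)"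
    using step.hyps by (simp_all only: insert_max_step comp_assoc less_Suc_eq_le Suc_diff_Suc)
  ultimately show ?case using step.IH by (simp only: zero_less_Suc power_Suc mult_ac)
qed

text \<open>Moving \<open>n + 1\<close> to position \<open>1\<close> contributes
  \<open>q ^ n\<close>, changing its sign contributes \<open>t\<close>, and moving
  \<open>- (n + 1)\<close> right past \<open>m\<close> larger entries contributes
  \<open>q ^ m\<close>.\<close>

lemma weight_insert_min:
  assumes v: "v \<in> hyperoctahedral n" and m: "m \<le> n"
  shows "weight q t (v \<circ> insert_min m n) = t * q ^ (n + m) * weight q t v"
  using m
proof (induction m)
  case 0
  let ?w = "v \<circ> insert_max 1 n"
  have "?w 0 = 0" "?w 1 = int n + 1"
    using hyperoctahedral_zero[OF v] hyperoctahedral_fix[OF v] by (simp_all add: insert_max_apply)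
  moreover have "?w \<in> hyperoctahedral (Suc n)"
    using v hyperoctahedral_mono[of n "Suc n"]
    by (intro hyperoctahedral_comp insert_max_hyperoctahedral) auto
  ultimately have "weight q t (?w \<circ> cox_gen 0) = t * weight q t ?w"
    by (subst weight_ascent) auto
  moreover have "v \<circ> insert_min 0 n = ?w \<circ> cox_gen 0" by (simp only: insert_min.simps comp_assoc)
  moreover have "weight q t ?w = q ^ n * weight q t v" using weight_insert_max[OF v, of 1] by simp
  ultimately show ?case by (simp only: add_0_right mult_ac)
next
  case (Suc m)
  let ?w = "v \<circ> insert_min m n"
  have "?w (int (Suc m)) = v (- (int n + 1))" "?w (int (Suc m) + 1) = v (int m + 1)"
    using Suc.prems by (simp_all add: insert_min_apply add.commute)
  moreover have "v (- (int n + 1)) = - (int n + 1)" "\<bar>v (int m + 1)\<bar> \<le> int n"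
    using hyperoctahedral_fix[OF v] hyperoctahedral_abs_le[OF v] Suc.prems by simp_all
  moreover have "?w \<in> hyperoctahedral (Suc n)"
    using v hyperoctahedral_mono[of n "Suc n"] Suc.prems
    by (intro hyperoctahedral_comp insert_min_hyperoctahedral) auto
  ultimately have "weight q t (?w \<circ> cox_gen (Suc m)) = q * weight q t ?w"
    by (subst weight_ascent) auto
  moreover have "v \<circ> insert_min (Suc m) n = ?w \<circ> cox_gen (Suc m)"
    by (simp only: insert_min.simps comp_assoc)
  moreover have "weight q t ?w = t * q ^ (n + m) * weight q t v"
    using Suc.prems by (intro Suc.IH) simp
  ultimately show ?case by (simp only: add_Suc_right power_Suc mult_ac)
qed

section \<open>Splitting a maximal quotient by the position of the largest value\<close>

text \<open>If \<open>u p = n + 1\<close>, then \<open>u \<circ> inv c\<close> fixes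
  \<open>n + 1\<close> and thus lies in \<open>B_n\<close>. A negative \<open>p\<close> treats the
  insertion of \<open>- (n + 1)\<close> at position \<open>- p\<close>.\<close>

lemma bij_betw_insert_max_value:
  assumes c: "c \<in> hyperoctahedral (Suc n)" "c p = int n + 1"
    and iff: "\<And>v. v \<in> hyperoctahedral n \<Longrightarrow>
      v \<circ> c \<in> parabolic_quotient (Suc n) K \<longleftrightarrow> v \<in> parabolic_quotient n J"
  shows "bij_betw (\<lambda>v. v \<circ> c) (parabolic_quotient n J)
    {u \<in> parabolic_quotient (Suc n) K. u p = int n + 1}"
proof (rule bij_betwI')
  have surj: "c \<circ> inv c = id" and inj: "inv c \<circ> c = id"
    using hyperoctahedral_bij[OF c(1)] by (simp_all add: bij_is_surj surj_iff[symmetric] bij_is_inj)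
  show "(v \<circ> c = v' \<circ> c) = (v = v')" for v v'
    using surj by (metis comp_assoc comp_id)
  show "v \<circ> c \<in> {u \<in> parabolic_quotient (Suc n) K. u p = int n + 1}"
    if "v \<in> parabolic_quotient n J" for v
    using that iff[of v] c(2) hyperoctahedral_fix[of v n "int n + 1"]
    by (simp add: parabolic_quotient_def)
  fix u assume u: "u \<in> {u \<in> parabolic_quotient (Suc n) K. u p = int n + 1}"
  have "u \<circ> inv c \<in> hyperoctahedral (Suc n)"
    using u by (intro hyperoctahedral_comp hyperoctahedral_inv c(1)) (simp add: parabolic_quotient_def)
  moreover have "inv c (int n + 1) = p"
    using c(2) inj by (metis comp_apply id_apply)
  ultimately have "u \<circ> inv c \<in> hyperoctahedral n"
    using u by (auto intro: hyperoctahedral_Suc_fixing[of "u \<circ> inv c"])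
  moreover have eq: "(u \<circ> inv c) \<circ> c = u" by (simp add: comp_assoc inj)
  ultimately have "u \<circ> inv c \<in> parabolic_quotient n J" using iff[of "u \<circ> inv c"] u by simp
  then show "\<exists>v\<in>parabolic_quotient n J. u = v \<circ> c" using eq by metis
qed

text \<open>Here \<open>n + 1\<close> ends the first increasing block; deleting it shortens that
  block by one, whence \<open>m - 1\<close>.\<close>

lemma sum_weight_insert_max:
  assumes m: "0 < m" "m \<le> n"
  shows "sum (weight q t) {u \<in> parabolic_quotient (Suc n) {m}. u (int m) = int n + 1} =
    q ^ (Suc n - m) * sum (weight q t) (parabolic_quotient n {m - 1})"
proof -
  let ?c = "insert_max m n"
  have "v \<circ> ?c \<in> parabolic_quotient (Suc n) {m} \<longleftrightarrow> v \<in> parabolic_quotient n {m - 1}"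
    if v: "v \<in> hyperoctahedral n" for v
  proof -
    have "(\<forall>i<Suc n. i \<noteq> m \<longrightarrow> v (?c (int i)) < v (?c (int i + 1))) \<longleftrightarrow>
      (\<forall>i<n. i \<noteq> m - 1 \<longrightarrow> v (int i) < v (int i + 1))" (is "?L \<longleftrightarrow> ?R")
    proof (intro iffI allI impI)
      fix i assume L: ?L and i: "i < n" "i \<noteq> m - 1"
      show "v (int i) < v (int i + 1)"
      proof (cases "i < m - 1")
        case True
        then have "int i < int m" "int i + 1 < int m" by linarith+
        then have "?c (int i) = int i" "?c (int i + 1) = int i + 1"
          using m by (simp_all add: insert_max_apply)
        then show ?thesis using L[rule_format, of i] True i by simp
      next
        case False
        \<comment> \<open>Now \<open>i \<ge> m\<close>, so the entry of \<open>v\<close> at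
          \<open>i\<close> stands one place further right, at \<open>i + 1\<close>.\<close>
        then have "\<not> int (Suc i) < int m" "int (Suc i) \<noteq> int m" using i by linarith+
        then have "?c (int (Suc i)) = int i" "?c (int (Suc i) + 1) = int i + 1"
          using i m by (simp_all add: insert_max_apply)
        then show ?thesis using L[rule_format, of "Suc i"] False i by simp
      qed
    next
      fix i assume R: ?R and i: "i < Suc n" "i \<noteq> m"
      have v_max: "v (int n + 1) = int n + 1" "\<bar>v (int m - 1)\<bar> \<le> int n"
        using hyperoctahedral_fix[OF v] hyperoctahedral_abs_le[OF v] m by simp_all
      consider "i < m - 1" | "i = m - 1" | "m < i" using i m by linarith
      then show "v (?c (int i)) < v (?c (int i + 1))"
      proof cases
        case 1
        then have "int i < int m" "int i + 1 < int m" by linarith+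
        then have "?c (int i) = int i" "?c (int i + 1) = int i + 1"
          using m by (simp_all add: insert_max_apply)
        then show ?thesis using R[rule_format, of i] 1 m by simp
      next
        \<comment> \<open>The ascent into position \<open>m\<close> is automatic, as
          \<open>n + 1\<close> is the largest value; it puts no condition on \<open>v\<close> at
          \<open>m - 1\<close>.\<close>
        case 2
        then have "int i < int m" "int i + 1 = int m" using m by linarith+
        then have "?c (int i) = int m - 1" "?c (int i + 1) = int n + 1"
          using m by (simp_all add: insert_max_apply)
        then show ?thesis using v_max by simp
      next
        case 3
        then have "?c (int i) = int (i - 1)" "?c (int i + 1) = int (i - 1) + 1"
          using i m by (simp_all add: insert_max_apply of_nat_diff)
        then show ?thesis using R[rule_format, of "i - 1"] 3 i m by simp
      qed
    qed
    moreover have "v \<circ> ?c \<in> hyperoctahedral (Suc n)"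
      using v hyperoctahedral_mono[of n "Suc n"]
      by (intro hyperoctahedral_comp insert_max_hyperoctahedral) auto
    ultimately show ?thesis using v by (simp add: parabolic_quotient_eq)
  qed
  then have "bij_betw (\<lambda>v. v \<circ> ?c) (parabolic_quotient n {m - 1})
      {u \<in> parabolic_quotient (Suc n) {m}. u (int m) = int n + 1}"
    using m by (intro bij_betw_insert_max_value insert_max_hyperoctahedral)
      (simp_all add: insert_max_apply)
  from sum.reindex_bij_betw[OF this, of "weight q t"] show ?thesis
    using m by (simp add: sum_distrib_left weight_insert_max parabolic_quotient_def)
qed

text \<open>Here \<open>- (n + 1)\<close> starts the second block; deleting it leaves the first
  block intact, so \<open>m\<close> stays.\<close>

lemma sum_weight_insert_min:
  assumes m: "m \<le> n"
  shows "sum (weight q t) {u \<in> parabolic_quotient (Suc n) {m}. u (- (int m + 1)) = int n + 1} =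
    t * q ^ (n + m) * sum (weight q t) (parabolic_quotient n {m})"
proof -
  let ?c = "insert_min m n"
  have iff: "v \<circ> ?c \<in> parabolic_quotient (Suc n) {m} \<longleftrightarrow> v \<in> parabolic_quotient n {m}"
    if v: "v \<in> hyperoctahedral n" for v
  proof -
    have "(\<forall>i<Suc n. i \<noteq> m \<longrightarrow> v (?c (int i)) < v (?c (int i + 1))) \<longleftrightarrow>
      (\<forall>i<n. i \<noteq> m \<longrightarrow> v (int i) < v (int i + 1))" (is "?L \<longleftrightarrow> ?R")
    proof (intro iffI allI impI)
      fix i assume L: ?L and i: "i < n" "i \<noteq> m"
      show "v (int i) < v (int i + 1)"
      proof (cases "i < m")
        case True
        then have "?c (int i) = int i" "?c (int i + 1) = int i + 1"
          using m by (simp_all add: insert_min_apply)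
        then show ?thesis using L[rule_format, of i] True i by simp
      next
        case False
        then have "?c (int (Suc i)) = int i" "?c (int (Suc i) + 1) = int i + 1"
          using i m by (simp_all add: insert_min_apply)
        then show ?thesis using L[rule_format, of "Suc i"] False i by simp
      qed
    next
      fix i assume R: ?R and i: "i < Suc n" "i \<noteq> m"
      consider "i < m" | "i = m + 1" | "m + 1 < i" using i by linarith
      then show "v (?c (int i)) < v (?c (int i + 1))"
      proof cases
        case 1
        then have "?c (int i) = int i" "?c (int i + 1) = int i + 1"
          using m by (simp_all add: insert_min_apply)
        then show ?thesis using R[rule_format, of i] 1 m by simp
      next
        \<comment> \<open>The ascent leaving position \<open>m + 1\<close> is automatic, as
          \<open>- (n + 1)\<close> is the smallest value.\<close>
        case 2
        then have "?c (int i) = - (int n + 1)" "?c (int i + 1) = int m + 1"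
          using i m by (simp_all add: insert_min_apply)
        moreover have "v (- (int n + 1)) = - (int n + 1)" "\<bar>v (int m + 1)\<bar> \<le> int n"
          using hyperoctahedral_fix[OF v] hyperoctahedral_abs_le[OF v] 2 i by simp_all
        ultimately show ?thesis by simp
      next
        case 3
        then have "?c (int i) = int (i - 1)" "?c (int i + 1) = int (i - 1) + 1"
          using i m by (simp_all add: insert_min_apply of_nat_diff)
        then show ?thesis using R[rule_format, of "i - 1"] 3 i m by simp
      qed
    qed
    moreover have "v \<circ> ?c \<in> hyperoctahedral (Suc n)"
      using v hyperoctahedral_mono[of n "Suc n"] m
      by (intro hyperoctahedral_comp insert_min_hyperoctahedral) auto
    ultimately show ?thesis using v by (simp add: parabolic_quotient_eq)
  qed
  have max: "?c (- (int m + 1)) = int n + 1"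
    using hyperoctahedral_odd[OF insert_min_hyperoctahedral[OF m], of "int m + 1"] m
    by (simp add: insert_min_apply)
  have "bij_betw (\<lambda>v. v \<circ> ?c) (parabolic_quotient n {m})
      {u \<in> parabolic_quotient (Suc n) {m}. u (- (int m + 1)) = int n + 1}"
    by (rule bij_betw_insert_max_value[OF insert_min_hyperoctahedral[OF m] max iff])
  from sum.reindex_bij_betw[OF this, of "weight q t"] show ?thesis
    using m by (simp add: sum_distrib_left weight_insert_min parabolic_quotient_def)
qed

text \<open>The insertion is the identity and the weight ignores \<open>n\<close>, so no factor
  arises; the extra ascent at \<open>n\<close> is automatic.\<close>

lemma sum_weight_fixing_max:
  assumes m: "m \<le> n"
  shows "sum (weight q t) {u \<in> parabolic_quotient (Suc n) {m}. u (int n + 1) = int n + 1} =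
    sum (weight q t) (parabolic_quotient n {m})"
proof -
  have "v \<circ> id \<in> parabolic_quotient (Suc n) {m} \<longleftrightarrow> v \<in> parabolic_quotient n {m}"
    if v: "v \<in> hyperoctahedral n" for v
  proof -
    have "v (int n) < v (int n + 1)"
      using hyperoctahedral_fix[OF v, of "int n + 1"] hyperoctahedral_abs_le[OF v, of "int n"] by simp
    then have "(\<forall>i<Suc n. i \<noteq> m \<longrightarrow> v (int i) < v (int i + 1)) \<longleftrightarrow>
        (\<forall>i<n. i \<noteq> m \<longrightarrow> v (int i) < v (int i + 1))"
      using less_Suc_eq by metis
    moreover have "v \<in> hyperoctahedral (Suc n)" using v hyperoctahedral_mono[of n "Suc n"] by auto
    ultimately show ?thesis using v by (simp add: parabolic_quotient_eq)
  qed
  then have "bij_betw (\<lambda>v. v \<circ> id) (parabolic_quotient n {m})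
      {u \<in> parabolic_quotient (Suc n) {m}. u (int n + 1) = int n + 1}"
    by (intro bij_betw_insert_max_value id_hyperoctahedral) simp_all
  from sum.reindex_bij_betw[OF this, of "weight q t"] show ?thesis by simp
qed

text \<open>The value \<open>n + 1\<close> can only occur at the end of one of the two increasing blocks, and
  \<open>-(n + 1)\<close> only at the start of the second.\<close>

lemma sum_weight_maximal_rec:
  fixes q t :: "'a::comm_ring_1"
  assumes m: "m \<le> n"
  shows "sum (weight q t) (parabolic_quotient (Suc n) {m}) =
    (if m = 0 then 0 else q ^ (Suc n - m) * sum (weight q t) (parabolic_quotient n {m - 1}))
    + (1 + t * q ^ (n + m)) * sum (weight q t) (parabolic_quotient n {m})"
proof -
  \<comment> \<open>\<open>A p\<close> collects the elements with \<open>n + 1\<close> at signed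
    position \<open>p\<close>.\<close>
  define A where "A p = {u \<in> parabolic_quotient (Suc n) {m}. u p = int n + 1}" for p
  have fin: "finite (A p)" for p
    by (rule finite_subset[OF _ finite_hyperoctahedral[of "Suc n"]])
      (auto simp: A_def parabolic_quotient_def)
  have disj: "A p \<inter> A p' = {}" if "p \<noteq> p'" for p p'
  proof -
    have "p = p'" if "u \<in> A p" "u \<in> A p'" for u
      using that inj_eq[OF hyperoctahedral_inj, of u "Suc n" p p']
      by (simp add: A_def parabolic_quotient_def)
    with that show ?thesis by blast
  qed
  \<comment> \<open>When \<open>m = 0\<close> the class \<open>A m\<close> is therefore empty, which
    gives the \<open>0\<close> in the recursion.\<close>
  have zero: "A 0 = {}"
  proof -
    have "u 0 \<noteq> int n + 1" if "u \<in> hyperoctahedral (Suc n)" for u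
      using hyperoctahedral_zero[OF that] by simp
    then show ?thesis by (auto simp: A_def parabolic_quotient_def)
  qed
  have "u \<in> A (int m) \<union> A (int n + 1) \<union> A (- (int m + 1))"
    if "u \<in> parabolic_quotient (Suc n) {m}" for u
  proof -
    have u: "u \<in> hyperoctahedral (Suc n)"
      and asc: "\<And>i. i < Suc n \<Longrightarrow> i \<noteq> m \<Longrightarrow> u (int i) < u (int i + 1)"
      using that by (auto simp: parabolic_quotient_eq)
    obtain p where p: "u p = int n + 1"
      using bij_is_surj[OF hyperoctahedral_bij[OF u]] by (metis surjD)
    have le: "\<bar>p\<bar> \<le> int (Suc n)" using hyperoctahedral_abs_le[OF u, of p] p by simp
    have "p = int m \<or> p = int n + 1 \<or> p = - (int m + 1)"
    proof (rule ccontr)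
      \<comment> \<open>At any other \<open>p\<close>, a neighbouring ascent forces a value above
        \<open>n + 1\<close> or below \<open>- (n + 1)\<close>.\<close>
      assume neg: "\<not> ?thesis"
      have "p \<noteq> 0" using p hyperoctahedral_zero[OF u] by auto
      then consider "0 < p" | "p < 0" by linarith
      then show False
      proof cases
        case 1
        then have "u p < u (p + 1)" using asc[of "nat p"] neg le by force
        moreover have "\<bar>u (p + 1)\<bar> \<le> int (Suc n)"
          using hyperoctahedral_abs_le[OF u, of "p + 1"] 1 neg le by simp
        ultimately show False using p by simp
      next
        case 2
        then have "u (- p - 1) < u (- p)" using asc[of "nat (- p - 1)"] neg le by force
        moreover have "\<bar>u (- p - 1)\<bar> \<le> int (Suc n)"
          using hyperoctahedral_abs_le[OF u, of "- p - 1"] 2 le by simp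
        ultimately show False using p hyperoctahedral_odd[OF u, of p] by simp
      qed
    qed
    then show ?thesis using that p by (auto simp: A_def)
  qed
  then have "parabolic_quotient (Suc n) {m} = A (int m) \<union> A (int n + 1) \<union> A (- (int m + 1))"
    by (auto simp: A_def)
  then have "sum (weight q t) (parabolic_quotient (Suc n) {m}) =
      sum (weight q t) (A (int m)) + sum (weight q t) (A (int n + 1))
      + sum (weight q t) (A (- (int m + 1)))"
    using m fin disj by (simp add: sum.union_disjoint Int_Un_distrib2)
  moreover have "sum (weight q t) (A (int m)) =
      (if m = 0 then 0 else q ^ (Suc n - m) * sum (weight q t) (parabolic_quotient n {m - 1}))"
    using sum_weight_insert_max[of m n q t] m zero by (cases "m = 0") (simp_all flip: A_def)
  moreover have "sum (weight q t) (A (int n + 1)) = sum (weight q t) (parabolic_quotient n {m})"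
    using sum_weight_fixing_max[OF m] by (simp add: A_def)
  moreover have "sum (weight q t) (A (- (int m + 1))) =
      t * q ^ (n + m) * sum (weight q t) (parabolic_quotient n {m})"
    using sum_weight_insert_min[OF m] by (simp add: A_def)
  ultimately show ?thesis by (simp add: algebra_simps)
qed

section \<open>Closed form for maximal quotients\<close>

text \<open>Besides \<open>I = {}\<close> this covers \<open>I = {n}\<close>, whose only index is
  out of range; both occur as base cases.\<close>

lemma parabolic_quotient_trivial:
  assumes "\<And>i. i < n \<Longrightarrow> i \<notin> I"
  shows "parabolic_quotient n I = {id}"
proof -
  have "w = id" if "w \<in> parabolic_quotient n I" for w
  proof (rule hyperoctahedral_no_descent_id)
    show w: "w \<in> hyperoctahedral n" using that by (simp add: parabolic_quotient_def)
    have asc: "w (int i) < w (int i + 1)" if "i < n" for i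
      using \<open>w \<in> parabolic_quotient n I\<close> assms that by (simp add: parabolic_quotient_eq)
    show "0 < w 1" if "0 < n" using asc[OF that] hyperoctahedral_zero[OF w] by simp
    show "w (int i) < w (int i + 1)" if "i < n" for i using asc[OF that] .
  qed
  moreover have "id \<in> parabolic_quotient n I"
    by (simp add: parabolic_quotient_eq id_hyperoctahedral)
  ultimately show ?thesis by auto
qed

lemma weight_id: "weight q t (\<lambda>i. i) = 1"
proof -
  have "long_inversions (\<lambda>i. i) = {}" "neg_positions (\<lambda>i. i) = {}"
    by (auto simp: long_inversions_def neg_positions_def)
  then show ?thesis by (simp add: weight_def)
qed

text \<open>Clearing denominators makes the formula valid in any commutative ring, for every
  \<open>q\<close>. It follows from the recursion by induction on \<open>n\<close>.\<close>

lemma sum_weight_maximal: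
  fixes q t :: "'a::comm_ring_1"
  assumes "m \<le> n"
  shows "sum (weight q t) (parabolic_quotient n {m}) * (qfact q (n - m) * qfact q m) =
    qfact q n * (\<Prod>i=m..<n. 1 + t * q ^ i)"
  using assms
proof (induction n arbitrary: m)
  case 0
  then show ?case by (simp add: parabolic_quotient_trivial weight_id qfact_def)
next
  case (Suc n)
  show ?case
  proof (cases "m = Suc n")
    case True
    then show ?thesis by (simp add: parabolic_quotient_trivial weight_id qfact_def)
  next
    case False
    then have m: "m \<le> n" using Suc.prems by simp
    define R where "R k = sum (weight q t) (parabolic_quotient n {k})" for k
    define P where "P = (\<Prod>i=m..<n. 1 + t * q ^ i)"
    have Rm: "R m * (qfact q (n - m) * qfact q m) = qfact q n * P"
      using Suc.IH[OF m] by (simp add: R_def P_def)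
    obtain d where d: "n = m + d" using m le_Suc_ex by blast
    show ?thesis
    proof (cases m)
      case 0
      have q0: "qfact q 0 = 1" by (simp add: qfact_def)
      have "sum (weight q t) (parabolic_quotient (Suc n) {m}) * (qfact q (Suc n - m) * qfact q m) =
          (R 0 * qfact q n) * ((1 - q ^ Suc n) * (1 + t * q ^ n))"
        using sum_weight_maximal_rec[OF m, of q t] 0 q0 by (simp add: R_def qfact_Suc mult_ac)
      also have "R 0 * qfact q n = qfact q n * P" using Rm 0 q0 by simp
      finally show ?thesis using 0 by (simp add: P_def qfact_Suc mult_ac)
    next
      case (Suc k)
      \<comment> \<open>For \<open>k = m - 1\<close> one has \<open>n - k = Suc n - m\<close>, and
        the product starts one index earlier, giving the factor
        \<open>1 + t * q ^ k\<close>.\<close>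
      have IH: "R k * (qfact q (Suc n - m) * qfact q k) = qfact q n * ((1 + t * q ^ k) * P)"
        using Suc.IH[of k] m Suc by (simp add: R_def P_def prod.atLeast_Suc_lessThan)
      have "R k * (qfact q (Suc n - m) * qfact q m) =
          (R k * (qfact q (Suc n - m) * qfact q k)) * (1 - q ^ m)"
        by (simp add: Suc qfact_Suc mult_ac)
      then have Rk: "R k * (qfact q (Suc n - m) * qfact q m) =
          qfact q n * P * ((1 - q ^ m) * (1 + t * q ^ k))"
        unfolding IH by (simp only: mult_ac)
      have "R m * (qfact q (Suc n - m) * qfact q m) =
          (R m * (qfact q (n - m) * qfact q m)) * (1 - q ^ (Suc n - m))"
        using m by (simp add: Suc_diff_le qfact_Suc mult_ac)
      then have Rm': "R m * (qfact q (Suc n - m) * qfact q m) =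
          qfact q n * P * (1 - q ^ (Suc n - m))"
        unfolding Rm .
      have "sum (weight q t) (parabolic_quotient (Suc n) {m}) = 
          q ^ (Suc n - m) * R k + (1 + t * q ^ (n + m)) * R m"
        using sum_weight_maximal_rec[OF m, of q t] Suc by (simp add: R_def)
      then have "sum (weight q t) (parabolic_quotient (Suc n) {m}) * (qfact q (Suc n - m) * qfact q m) =
          q ^ (Suc n - m) * (R k * (qfact q (Suc n - m) * qfact q m))
          + (1 + t * q ^ (n + m)) * (R m * (qfact q (Suc n - m) * qfact q m))"
        by (simp add: algebra_simps)
      also have "\<dots> = qfact q n * P * (q ^ (Suc n - m) * ((1 - q ^ m) * (1 + t * q ^ k))
          + (1 + t * q ^ (n + m)) * (1 - q ^ (Suc n - m)))"
        unfolding Rk Rm' by (simp add: algebra_simps)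
      \<comment> \<open>On expanding, the terms \<open>q ^ (Suc n - m)\<close> and
        \<open>t * q ^ (n + m)\<close> cancel.\<close>
      also have "q ^ (Suc n - m) * ((1 - q ^ m) * (1 + t * q ^ k))
          + (1 + t * q ^ (n + m)) * (1 - q ^ (Suc n - m)) = (1 - q ^ Suc n) * (1 + t * q ^ n)"
        by (simp add: d Suc algebra_simps power_add)
      also have "qfact q n * P * ((1 - q ^ Suc n) * (1 + t * q ^ n)) =
          qfact q (Suc n) * (\<Prod>i=m..<Suc n. 1 + t * q ^ i)"
        using m by (simp add: P_def qfact_Suc mult_ac)
      finally show ?thesis .
    qed
  qed
qed

section \<open>The generating function\<close>

lemma qfact_nonzero:
  fixes q :: "'a::idom_divide"
  assumes "\<And>k. k > 0 \<Longrightarrow> q ^ k \<noteq> 1"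
  shows "qfact q n \<noteq> 0"
  using assms by (auto simp: qfact_def)

text \<open>The division is exact by \<open>qfact_mult_dvd\<close>, and the divisor is nonzero
  because no positive power of \<open>q\<close> is \<open>1\<close>.\<close>

lemma qbinom_mult_qfact:
  fixes q :: "'a::idom_divide"
  assumes "\<And>k. k > 0 \<Longrightarrow> q ^ k \<noteq> 1" and "m \<le> n"
  shows "qbinom q n m * (qfact q (n - m) * qfact q m) = qfact q n"
proof -
  obtain c where "qfact q n = qfact q (n - m) * qfact q m * c"
    using qfact_mult_dvd[of q "n - m" m] assms(2) by (auto elim: dvdE)
  then show ?thesis using qfact_nonzero[OF assms(1)] by (simp add: qbinom_def)
qed

text \<open>The new maximum \<open>m\<close> stands just before \<open>n\<close> in the list;
  dropping \<open>n\<close> leaves the list for \<open>I\<close> with endpoint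
  \<open>m\<close>.\<close>

lemma qmultinom_insert:
  fixes q :: "'a::idom_divide"
  assumes "finite I" and "\<forall>i\<in>I. i < m"
  shows "qmultinom q n (insert m I) = qbinom q n m * qmultinom q m I"
proof -
  define xs where "xs = sorted_list_of_set I"
  have len: "length xs = card I" by (simp add: xs_def)
  have "sorted_list_of_set (set (xs @ [m])) = xs @ [m]"
    using assms by (intro sorted_list_of_set.idem_if_sorted_distinct)
      (auto simp: xs_def sorted_append less_imp_le)
  then have "sorted_list_of_set (insert m I) = xs @ [m]"
    using assms(1) by (simp add: xs_def)
  moreover have "card (insert m I) = Suc (card I)" using assms by auto
  ultimately have "qmultinom q n (insert m I) =
      (\<Prod>j<Suc (card I). qbinom q (((xs @ [m]) @ [n]) ! Suc j) (((xs @ [m]) @ [n]) ! j))"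
    by (simp only: qmultinom_def Let_def)
  also have "\<dots> = (\<Prod>j<card I. qbinom q (((xs @ [m]) @ [n]) ! Suc j) (((xs @ [m]) @ [n]) ! j))
      * qbinom q n m"
    using len by (simp add: nth_append)
  also have "(\<Prod>j<card I. qbinom q (((xs @ [m]) @ [n]) ! Suc j) (((xs @ [m]) @ [n]) ! j)) =
      (\<Prod>j<card I. qbinom q ((xs @ [m]) ! Suc j) ((xs @ [m]) ! j))"
    using len by (intro prod.cong refl) (simp add: nth_append)
  also have "\<dots> = qmultinom q m I" by (simp add: qmultinom_def Let_def xs_def)
  finally show ?thesis by (simp add: mult.commute)
qed

lemma qpoch_eq_prod:
  fixes q t :: "'a::comm_ring_1"
  shows "qpoch (- (t * q ^ i)) q (n - i) = (\<Prod>j=i..<n. 1 + t * q ^ j)"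
  unfolding qpoch_def prod.atLeastLessThan_shift_0[of _ i n]
  by (simp add: power_add mult.assoc atLeast0LessThan)

text \<open>Induction removes the maximum \<open>m\<close> of the index set: the multinomial splits
  off \<open>qbinom q n m\<close>, and the product over indices from the least one up to
  \<open>n\<close> splits at \<open>m\<close>.\<close>

lemma sum_weight_parabolic_quotient:
  fixes q t :: "'a::idom_divide"
  assumes q: "\<And>k. k > 0 \<Longrightarrow> q ^ k \<noteq> 1" and "I \<subseteq> {..<n}"
  shows "sum (weight q t) (parabolic_quotient n I) =
    qmultinom q n I * (\<Prod>i=least_index n I..<n. 1 + t * q ^ i)"
proof -
  have "finite I" using assms(2) finite_subset by blast
  then show ?thesis using assms(2)
  proof (induction I arbitrary: n rule: finite_linorder_max_induct)
    case empty
    then show ?case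
      by (simp add: parabolic_quotient_trivial weight_id qmultinom_def least_index_def)
  next
    case (insert m I)
    have m: "m < n" and I: "I \<subseteq> {..<m}" using insert by auto
    have "sum (weight q t) (parabolic_quotient n {m}) * (qfact q (n - m) * qfact q m) =
        (qbinom q n m * (\<Prod>i=m..<n. 1 + t * q ^ i)) * (qfact q (n - m) * qfact q m)"
      using sum_weight_maximal[of m n q t] qbinom_mult_qfact[OF q, of m n] m by (simp add: mult_ac)
    then have max: "sum (weight q t) (parabolic_quotient n {m}) =
        qbinom q n m * (\<Prod>i=m..<n. 1 + t * q ^ i)"
      using qfact_nonzero[OF q] by simp
    have "Min I < m" if "I \<noteq> {}" using insert.hyps that by simp
    \<comment> \<open>For empty \<open>I\<close> the default \<open>least_index m {} = m\<close> is
      exactly the least element of \<open>{m}\<close>.\<close>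
    then have least: "least_index n (insert m I) = least_index m I" "least_index m I \<le> m"
      using insert.hyps(1) by (cases "I = {}"; simp add: least_index_def)+
    have "(\<Prod>i=least_index m I..<n. 1 + t * q ^ i) =
        (\<Prod>i=least_index m I..<m. 1 + t * q ^ i) * (\<Prod>i=m..<n. 1 + t * q ^ i)"
      using least(2) m by (simp add: prod.atLeastLessThan_concat)
    then show ?case
      using sum_weight_parabolic_factorisation[OF m I, of q t] insert.IH[OF I] max
        qmultinom_insert[of I m q n] insert.hyps
      by (simp add: least(1) mult_ac)
  qed
qed

section \<open>Specialisation to the two polynomials\<close>

lemma pX_power_neq_1: "k > 0 \<Longrightarrow> pX ^ k \<noteq> 1"
  by (metis degree_1 degree_monom_eq monom_power mult_1 not_gr_zero power_one one_neq_zero)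

theorem proposition4p6:
  fixes n \<delta> :: nat and I :: "nat set"
  assumes "\<delta> \<in> {0, 1}" and "I \<subseteq> {..<n}"
  shows "f_F n \<delta> I =
           (\<Sum>w\<in>parabolic_quotient n I.
              (- 1) ^ neg_count n w * pX ^ nat (F_exponent n \<delta> w))
       \<and> f_G n I =
           (\<Sum>w\<in>parabolic_quotient n I.
              (- 1) ^ neg_count n w * pX ^ cox_length n w)"
proof
  have "f_F n \<delta> I = sum (weight (pX ^ 2) (- (pX ^ (2 * \<delta> + 1)))) (parabolic_quotient n I)"
  proof -
    have neq_1: "(pX ^ 2) ^ k \<noteq> 1" if "k > 0" for k
      using pX_power_neq_1[of "2 * k"] that by (simp add: power_mult)
    \<comment> \<open>The exponent splits as \<open>2 * \<delta> + 1\<close> plus twice the least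
      index, so this is \<open>- (t * q ^ i)\<close> as in \<open>qpoch_eq_prod\<close>.\<close>
    have "pX ^ (2 * (least_index n I + \<delta>) + 1) =
        - (- (pX ^ (2 * \<delta> + 1)) * (pX ^ 2) ^ least_index n I)"
      by (simp add: algebra_simps flip: power_mult power_add power_Suc)
    then show ?thesis
      using sum_weight_parabolic_quotient[OF neq_1 assms(2), of "- (pX ^ (2 * \<delta> + 1))"]
      unfolding f_F_def by (simp only: qpoch_eq_prod)
  qed
  also have "\<dots> = (\<Sum>w\<in>parabolic_quotient n I.
      (- 1) ^ neg_count n w * pX ^ nat (F_exponent n \<delta> w))"
  proof (rule sum.cong[OF refl])
    fix w assume "w \<in> parabolic_quotient n I"
    then have w: "w \<in> hyperoctahedral n" by (simp add: parabolic_quotient_def)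
    \<comment> \<open>A negative position also counts once in the length, so its coefficient is
      \<open>2 + (2 * \<delta> - 1)\<close>.\<close>
    have "nat (F_exponent n \<delta> w) =
        (2 * \<delta> + 1) * card (neg_positions w) + 2 * card (long_inversions w)"
      unfolding F_exponent_def cox_length_eq[OF w] neg_count_eq_card[OF w]
      by (subst nat_eq_iff) (simp add: algebra_simps)
    then show "weight (pX ^ 2) (- (pX ^ (2 * \<delta> + 1))) w =
        (- 1) ^ neg_count n w * pX ^ nat (F_exponent n \<delta> w)"
      unfolding weight_def neg_count_eq_card[OF w]
      by (subst power_minus) (simp only: power_add power_mult mult.assoc)
  qed
  finally show "f_F n \<delta> I = \<dots>" .
  have "f_G n I = sum (weight pX (- pX)) (parabolic_quotient n I)"
  proof -
    have "pX ^ (least_index n I + 1) = - (- pX * pX ^ least_index n I)" by simp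
    then show ?thesis
      using sum_weight_parabolic_quotient[OF pX_power_neq_1 assms(2), of "- pX"]
      unfolding f_G_def by (simp only: qpoch_eq_prod)
  qed
  also have "\<dots> = (\<Sum>w\<in>parabolic_quotient n I. (- 1) ^ neg_count n w * pX ^ cox_length n w)"
  proof (rule sum.cong[OF refl])
    fix w assume "w \<in> parabolic_quotient n I"
    then have w: "w \<in> hyperoctahedral n" by (simp add: parabolic_quotient_def)
    show "weight pX (- pX) w = (- 1) ^ neg_count n w * pX ^ cox_length n w"
      unfolding weight_def cox_length_eq[OF w] neg_count_eq_card[OF w]
      by (subst power_minus) (simp only: power_add mult_ac)
  qed
  finally show "f_G n I = \<dots>" .
qed

end
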